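(* If $\ell$ is a positive integer, then the fourth central moment of the crosscorrelation demerit factor over all pairs of binary sequences of length $\ell$ (uniformly distributed) is \[ \mu^\ell_{4,(f,g)} \mathrm{CDF}(f,g) =\begin{cases} \dfrac{ 80\ell^6 + 2208\ell^5 - 17080\ell^4 + 43640\ell^3 - 47020\ell^2 + 18352\ell }{15\ell^8} & \text{if $\ell$ is even,} \\[2ex] \dfrac{ 80\ell^6 + 2208\ell^5 - 17080\ell^4 + 43640\ell^3 - 47380\ell^2 + 19792\ell -1260 }{15\ell^8} & \text{if $\ell$ is odd.} \end{cases} \]
   Context: A binary sequence of length $\ell$ is a doubly infinite list $f=(f_j)_{j\in\mathbb{Z}}$ with $f_j\in\{-1,1\}$ for $0\le j\le \ell-1$ and $f_j=0$ for all other $j$. For sequences $f,g$ of complex numbers with finitely many nonzero terms and $s\in\mathbb{Z}$, the aperiodic crosscorrelation is $C_{f,g}(s)=\sum_{j\in\mathbb{Z}} f_{j+s}\overline{g_j}$. For nonzero $f,g$, the crosscorrelation demerit factor is \[ \mathrm{CDF}(f,g)=\frac{\sum_{s\in\mathbb{Z}}|C_{f,g}(s)|^2}{C_{f,f}(0)\,C_{g,g}(0)}. \] $\mathrm{Pair}(\ell)$ is the set of all $2^{2\ell}$ ordered pairs $(f,g)$ of binary sequences of length $\ell$, with uniform probability measure; $\mathbb{E}^\ell_{(f,g)} v(f,g)$ is the expected value of a random variable $v$ with respect to this measure, and its $p$th central moment is $\mu^\ell_{p,(f,g)} v(f,g)=\mathbb{E}^\ell_{(f,g)}\bigl(v(f,g)-\mathbb{E}^\ell_{(f,g)}v(f,g)\bigr)^p$.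 *)

theory Defs
  imports "HOL-Probability.Probability" "HOL-Library.Groups_Big_Fun"
begin

text \<open>
  A sequence is a function \<^typ>\<open>int \<Rightarrow> complex\<close>.  \<^const>\<open>Sum_any\<close> sums over the whole of \<open>\<int>\<close>;
  it gives the intended value whenever only finitely many summands are nonzero, which is the
  case for all sums below as soon as \<open>f\<close> and \<open>g\<close> have finite support.
\<close>

definition binary_seqs :: "nat \<Rightarrow> (int \<Rightarrow> complex) set" where
  "binary_seqs l = {f. (\<forall>j. 0 \<le> j \<and> j \<le> int l - 1 \<longrightarrow> f j \<in> {-1, 1}) \<and>
                       (\<forall>j. \<not> (0 \<le> j \<and> j \<le> int l - 1) \<longrightarrow> f j = 0)}"

definition crosscorr :: "(int \<Rightarrow> complex) \<Rightarrow> (int \<Rightarrow> complex) \<Rightarrow> int \<Rightarrow> complex" where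
  "crosscorr f g s = Sum_any (\<lambda>j. f (j + s) * cnj (g j))"

text \<open>
  The two autocorrelations at shift \<open>0\<close> are nonnegative real numbers, so taking real parts only
  changes the type; see \<open>of_real_CDF\<close> below.
\<close>

definition CDF :: "(int \<Rightarrow> complex) \<Rightarrow> (int \<Rightarrow> complex) \<Rightarrow> real" where
  "CDF f g = Sum_any (\<lambda>s. (cmod (crosscorr f g s))\<^sup>2) /
             (Re (crosscorr f f 0) * Re (crosscorr g g 0))"

definition Pair_set :: "nat \<Rightarrow> ((int \<Rightarrow> complex) \<times> (int \<Rightarrow> complex)) set" where
  "Pair_set l = binary_seqs l \<times> binary_seqs l"

definition Pair_expectation ::
    "nat \<Rightarrow> ((int \<Rightarrow> complex) \<times> (int \<Rightarrow> complex) \<Rightarrow> real) \<Rightarrow> real" where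
  "Pair_expectation l v = measure_pmf.expectation (pmf_of_set (Pair_set l)) v"

definition Pair_central_moment ::
    "nat \<Rightarrow> nat \<Rightarrow> ((int \<Rightarrow> complex) \<times> (int \<Rightarrow> complex) \<Rightarrow> real) \<Rightarrow> real" where
  "Pair_central_moment l p v = Pair_expectation l (\<lambda>x. (v x - Pair_expectation l v) ^ p)"

lemma crosscorr_self_0_real: "crosscorr f f 0 \<in> \<real>"
  unfolding crosscorr_def Sum_any.expand_set
  by (auto intro!: sum_in_Reals simp: complex_mult_cnj)

lemma of_real_CDF:
  "complex_of_real (CDF f g) =
     of_real (Sum_any (\<lambda>s. (cmod (crosscorr f g s))\<^sup>2)) / (crosscorr f f 0 * crosscorr g g 0)"
  using crosscorr_self_0_real[of f] crosscorr_self_0_real[of g]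
  by (simp add: CDF_def of_real_Re)

text \<open>
  \<^const>\<open>pmf_of_set\<close> is the uniform distribution only on a finite nonempty set, which
  \<^const>\<open>Pair_set\<close> is.
\<close>

lemma bij_betw_binary_seqs:
  "bij_betw (\<lambda>f. restrict f {0..int l - 1}) (binary_seqs l) (PiE {0..int l - 1} (\<lambda>_. {-1, 1}))"
  by (rule bij_betw_byWitness[where f' = "\<lambda>h j. if j \<in> {0..int l - 1} then h j else 0"])
     (auto simp: binary_seqs_def fun_eq_iff PiE_def extensional_def Pi_def)

lemma finite_binary_seqs: "finite (binary_seqs l)"
  using bij_betw_finite[OF bij_betw_binary_seqs] by (simp add: finite_PiE)

lemma card_binary_seqs: "card (binary_seqs l) = 2 ^ l"
  using bij_betw_same_card[OF bij_betw_binary_seqs] by (simp add: card_PiE numeral_2_eq_2)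

lemma finite_Pair_set: "finite (Pair_set l)"
  by (simp add: Pair_set_def finite_binary_seqs)

lemma card_Pair_set: "card (Pair_set l) = 2 ^ (2 * l)"
  by (simp add: Pair_set_def card_cartesian_product card_binary_seqs power_add mult_2)

lemma Pair_set_nonempty: "Pair_set l \<noteq> {}"
  using card_Pair_set[of l] by force

end

theory Submission
  imports Defs
begin

text \<open>
  Write $A_s(f) = \sum_j f_j f_{j+s}$.  Summing $C_{f,g}(s)^2$ over all shifts gives
  $\sum_s A_s(f) A_s(g)$, so CDF$(f,g) - 1$ is $2/\ell^2$ times $\sum_{s=1}^{\ell-1} A_s(f) A_s(g)$
  and the fourth central moment is $16/\ell^8$ times the sum of the squares of
  $E(A_a A_b A_c A_d)$ over all $a,b,c,d$ in $1..\ell-1$.  This expectation counts the quadruples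
  of edges $\{i,i+a\}$, $\{j,j+b\}$, $\{k,k+c\}$ and $\{m,m+d\}$ in $\{0,\ldots,\ell-1\}$ whose
  union (with multiplicity) has only even degrees; these are two doubled edges or a 4-cycle.
  It therefore vanishes unless, up to permutation, $a+b=c+d$ or $d=a+b+c$, and it is a piecewise
  polynomial in the lengths in each of these cases.
\<close>

section \<open>Balanced quadruples of edges\<close>

text \<open>The squares come from the independence of \<open>f\<close> and \<open>g\<close>: for
  fixed lengths the expectation over pairs factors into two equal expectations over one sequence.
  The obstacle is the overlap of cases: a closed walk may degenerate into doubled edges, and
  different walks may then describe the same positions. The lengths are therefore separated into
  four types: all equal; two distinct pairs; one length the sum of the others; two equal sums with a
  strictly longest and a strictly shortest length. Apart from doubled edges, every solution is a
  translate of a rigid figure, so a figure contributes the positive part of \<open>n\<close> minus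
  its span, which truncated subtraction expresses directly. The leading term of the moment comes
  from doubled edges alone: three pairings times (n^3/3)^2, which the factor 16 turns into 80/15
  times n^6. Parity enters only through sums whose positive parts shrink by two per step:
  \<open>n - 2 * a\<close> on the diagonal that two distinct pairs exclude, and
  \<open>n - 1 - 2 * b\<close> for two equal sums.\<close>

text \<open>The edges $\{i,i+a\}$, $\{j,j+b\}$, $\{k,k+c\}$, $\{l,l+d\}$ meet every point an even number of times.\<close>

definition balanced :: "nat \<Rightarrow> nat \<Rightarrow> nat \<Rightarrow> nat \<Rightarrow> nat
    \<Rightarrow> nat \<Rightarrow> nat \<Rightarrow> nat \<Rightarrow> bool" where
  "balanced a b c d i j k l \<longleftrightarrow>
     sym_diff {i, i + a} {j, j + b} = sym_diff {k, k + c} {l, l + d}"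

text \<open>The two directions are spelled out as equations, so that eliminating the disjunction
  leaves linear relations between starting points and lengths.\<close>

definition edge :: "nat \<Rightarrow> nat \<Rightarrow> nat \<Rightarrow> nat
    \<Rightarrow> bool" where
  "edge s i x y \<longleftrightarrow> x = i \<and> y = i + s \<or> y = i \<and> x = i + s"

text \<open>The four edges, in the given order, form a closed walk that runs through the first one upwards.\<close>

definition cycle :: "nat \<Rightarrow> nat \<Rightarrow> nat \<Rightarrow> nat \<Rightarrow> nat
    \<Rightarrow> nat \<Rightarrow> nat \<Rightarrow> nat \<Rightarrow> bool" where
  "cycle a b c d i j k l \<longleftrightarrow> (\<exists>v w. edge b j (i + a) v \<and> edge c k v w
      \<and> edge d l w i)"

text \<open>Symmetric difference is commutative and associative, so balance does not depend on the
  order of the edges. The third exchange is the one that moves single edges across the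
  equation.\<close>

lemma balanced_swap:
  "balanced a b c d i j k l \<longleftrightarrow> balanced b a c d j i k l"
  "balanced a b c d i j k l \<longleftrightarrow> balanced c d a b k l i j"
  "balanced a b c d i j k l \<longleftrightarrow> balanced a c b d i k j l"
  "balanced a b c d i j k l \<longleftrightarrow> balanced a b d c i j l k"
proof -
  show "balanced a b c d i j k l \<longleftrightarrow> balanced b a c d j i k l"
    unfolding balanced_def by (simp add: Un_commute)
  show "balanced a b c d i j k l \<longleftrightarrow> balanced c d a b k l i j"
    unfolding balanced_def by (rule eq_commute)
  show "balanced a b c d i j k l \<longleftrightarrow> balanced a b d c i j l k"
    unfolding balanced_def by (simp add: Un_commute)
  have "sym_diff A B = sym_diff C D \<longleftrightarrow> sym_diff A C
      = sym_diff B D" for A B C D :: "nat set"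
    unfolding set_eq_iff Un_iff Diff_iff by (intro iff_allI) blast
  then show "balanced a b c d i j k l \<longleftrightarrow> balanced a c b d i k j l"
    unfolding balanced_def .
qed

lemma sym_diff_empty: "sym_diff A B = {} \<Longrightarrow> A = B"
  by blast

lemma sym_diff_self: "sym_diff A (sym_diff A B) = B"
  by blast

text \<open>Cancelling \<open>{u, w}\<close> gives \<open>Q\<close> as the symmetric difference of
  \<open>{u, w}\<close> and \<open>{u, v}\<close>; with \<open>w = v\<close> it would be
  empty.\<close>

lemma sym_diff_doubletons_aux:
  assumes "sym_diff {u, w} Q = {u, v}" "u \<noteq> v" "u \<noteq> w" "Q \<noteq> {}"
  shows "Q = {w, v}"
proof -
  have "Q = sym_diff {u, w} (sym_diff {u, w} Q)" by (rule sym_diff_self[symmetric])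
  also have "\<dots> = sym_diff {u, w} {u, v}" unfolding assms(1) ..
  finally have Q: "Q = sym_diff {u, w} {u, v}" .
  have "w \<noteq> v"
  proof
    assume "w = v"
    with Q assms(4) show False by simp
  qed
  with Q assms(2,3) show ?thesis by (simp add: insert_Diff_if insert_commute)
qed

lemma doubleton_other:
  assumes "x \<in> {a, b}" "a \<noteq> b"
  shows "\<exists>w. {a, b} = {x, w} \<and> x \<noteq> w"
proof (cases "x = a")
  case True
  then show ?thesis using assms(2) by blast
next
  case False
  then have "x = b" using assms(1) by simp
  then have "{a, b} = {x, a} \<and> x \<noteq> a" using assms(2) by (simp add: insert_commute)
  then show ?thesis ..
qed

text \<open>Two edges whose only points of odd degree are \<open>u\<close> and \<open>v\<close> form
  a path of length two. The witness \<open>w\<close> is its midpoint, and the disjunction records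
  which of the edges touches \<open>v\<close>.\<close>

lemma sym_diff_doubletons:
  assumes "sym_diff {p, p'} {q, q'} = {u, v}" "u \<noteq> v" "p \<noteq> p'" "q \<noteq> q'"
  shows "\<exists>w. {p, p'} = {v, w} \<and> {q, q'} = {w, u} \<or> {q, q'} = {v, w} \<and> {p, p'}
      = {w, u}"
proof -
  have "u \<in> sym_diff {p, p'} {q, q'}" unfolding assms(1) by simp
  then consider "u \<in> {p, p'}" | "u \<in> {q, q'}" by (elim UnE DiffE)
  then show ?thesis
  proof cases
    case 1
    from doubleton_other[OF 1 assms(3)] obtain w where w: "{p, p'} = {u, w}" "u \<noteq> w"
      by (elim exE conjE)
    have "{q, q'} = {w, v}" using assms(1)[unfolded w(1)] assms(2) w(2)
      by (rule sym_diff_doubletons_aux) simp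
    then have "{q, q'} = {v, w}" "{p, p'} = {w, u}" using w(1) by (simp_all only: insert_commute)
    then show ?thesis by (intro exI[of _ w] disjI2 conjI)
  next
    case 2
    from doubleton_other[OF 2 assms(4)] obtain w where w: "{q, q'} = {u, w}" "u \<noteq> w"
      by (elim exE conjE)
    have "{p, p'} = {w, v}" using assms(1)[unfolded w(1) Un_commute[of "{p, p'}
        - {u, w}"]] assms(2) w(2)
      by (rule sym_diff_doubletons_aux) simp
    then have "{p, p'} = {v, w}" "{q, q'} = {w, u}" using w(1) by (simp_all only: insert_commute)
    then show ?thesis by (intro exI[of _ w] disjI1 conjI)
  qed
qed

lemma edge_iff: "edge s i x y \<longleftrightarrow> {i, i + s} = {x, y}"
  by (auto simp: edge_def doubleton_eq_iff)

text \<open>The second edge leads from the top \<open>i + a\<close> of the first one to some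
  \<open>v\<close>. If \<open>v = i\<close>, the edge is doubled and the other two must coincide.
  Otherwise the first two edges leave odd degree at \<open>i\<close> and \<open>v\<close>, so the
  other two form a path from \<open>v\<close> back to \<open>i\<close>, in one of two
  orders.\<close>

lemma balanced_adjacent:
  assumes "a > 0" "b > 0" "c > 0" "d > 0" "balanced a b c d i j k l" "i + a \<in> {j, j + b}"
  shows "i = j \<and> a = b \<and> k = l \<and> c = d \<or> cycle a b c d i j k l
      \<or> cycle a b d c i j l k"
proof -
  obtain v where v: "{j, j + b} = {i + a, v}" "v \<noteq> i + a" using assms(2,6) by fastforce
  show ?thesis
  proof (cases "v = i")
    case True
    then have eq: "{j, j + b} = {i, i + a}" using v by (simp add: insert_commute)
    then have "edge b j i (i + a)" by (simp add: edge_iff)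
    then have "i = j \<and> a = b" using assms(1,2) by (auto simp: edge_def)
    have "sym_diff {k, k + c} {l, l + d} = {}"
      using assms(5) unfolding balanced_def eq by simp
    then have "{k, k + c} = {l, l + d}" by (rule sym_diff_empty)
    then have "edge c k l (l + d)" by (simp add: edge_iff)
    then have "k = l \<and> c = d" using assms(3,4) by (auto simp: edge_def)
    then show ?thesis using \<open>i = j \<and> a = b\<close> by simp
  next
    case False
    have "sym_diff {i, i + a} {i + a, v} = {i, v}"
      using assms(1) v(2) False by (simp add: insert_Diff_if insert_commute)
    then have "sym_diff {k, k + c} {l, l + d} = {i, v}"
      using assms(5) unfolding balanced_def v(1) by simp
    then have "\<exists>w. edge c k v w \<and> edge d l w i \<or> edge d l v w \<and> edge c k w i"
      unfolding edge_iff by (rule sym_diff_doubletons) (use False assms(3,4) in auto)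
    moreover have "edge b j (i + a) v" using v(1) by (simp only: edge_iff)
    ultimately show ?thesis
      unfolding cycle_def by blast
  qed
qed

text \<open>The degree of \<open>i + a\<close> is even, so another edge meets this point, and an
  exchange moves that edge to the second place. Starting at the top of the first edge fixes the
  direction of the walk; the six cycles are the orders of the other three edges.\<close>

lemma balanced_cases:
  assumes "a > 0" "b > 0" "c > 0" "d > 0" "balanced a b c d i j k l"
  shows "i = j \<and> a = b \<and> k = l \<and> c = d \<or> i = k \<and> a = c \<and> j = l \<and> b
      = d \<or> i = l \<and> a = d \<and> j = k \<and> b = c \<or>
    cycle a b c d i j k l \<or> cycle a b d c i j l k \<or> cycle a c b d i k j l
        \<or> cycle a c d b i k l j \<or>
    cycle a d b c i l j k \<or> cycle a d c b i l k j"
proof -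
  have sw: "balanced a c b d i k j l" "balanced a d b c i l j k"
    using assms(5) balanced_swap(3)[of a b c d i j k l] balanced_swap(4)[of a b c d i j k l]
      balanced_swap(3)[of a b d c i j l k] by simp_all
  have "i + a \<in> sym_diff {i, i + a} {j, j + b} \<longleftrightarrow> i + a \<in> sym_diff {k, k
      + c} {l, l + d}"
    using assms(5) by (simp only: balanced_def)
  then consider "i + a \<in> {j, j + b}" | "i + a \<in> {k, k + c}" | "i + a \<in> {l, l + d}"
    by auto
  then show ?thesis
  proof cases
    case 1
    from balanced_adjacent[OF assms 1] show ?thesis by (elim disjE) simp_all
  next
    case 2
    from balanced_adjacent[OF assms(1,3,2,4) sw(1) 2] show ?thesis by (elim disjE) simp_all
  next
    case 3
    from balanced_adjacent[OF assms(1,4,2,3) sw(2) 3] show ?thesis by (elim disjE) simp_all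
  qed
qed

text \<open>One disjunct for each choice of directions in which the walk can run through the last three edges.\<close>

lemma cycle_iff:
  assumes "a > 0" "b > 0" "c > 0" "d > 0"
  shows "cycle a b c d i j k l \<longleftrightarrow>
         a + b + c = d \<and> j = i + a \<and> k = j + b \<and> l = i \<or>
         a + b + d = c \<and> j = i + a \<and> i = l + d \<and> k = l \<or>
         a + c + d = b \<and> j + b = i + a \<and> k = j \<and> l = j + c \<or>
         b + c + d = a \<and> j + b = i + a \<and> k + c = j \<and> l = i \<or>
         a + b = c + d \<and> j = i + a \<and> k = i + d \<and> l = i \<or>
         a + c = b + d \<and> j + b = i + a \<and> k = j \<and> l = i \<or>
         a + d = b + c \<and> j + b = i + a \<and> i = l + d \<and> k = l"
    (is "_ \<longleftrightarrow> ?R")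
proof
  \<comment> \<open>Of the eight choices of directions, the one with all edges upwards would need
    \<open>a + b + c + d = 0\<close>; positivity leaves seven.\<close>
  show "cycle a b c d i j k l \<Longrightarrow> ?R"
    using assms unfolding cycle_def edge_def by (elim exE conjE disjE) simp_all
next
  have wit: "edge b j (i + a) v \<Longrightarrow> edge c k v w \<Longrightarrow> edge d l w i
      \<Longrightarrow> cycle a b c d i j k l" for v w
    unfolding cycle_def by blast
  show "?R \<Longrightarrow> cycle a b c d i j k l"
    apply (elim disjE conjE)
    subgoal by (rule wit[of "j + b" "l + d"]) (simp_all add: edge_def)
    subgoal by (rule wit[of "j + b" l]) (simp_all add: edge_def)
    subgoal by (rule wit[of j l]) (simp_all add: edge_def)
    subgoal by (rule wit[of j "l + d"]) (simp_all add: edge_def)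
    subgoal by (rule wit[of "j + b" "l + d"]) (simp_all add: edge_def)
    subgoal by (rule wit[of j "l + d"]) (simp_all add: edge_def)
    subgoal by (rule wit[of j l]) (simp_all add: edge_def)
    done
qed

text \<open>Only consecutive points have to differ. If \<open>t = v\<close>, the walk consists of
  doubled edges and both sides are empty; otherwise both sides equal \<open>{t, v}\<close>.\<close>

lemma sym_diff_closed_walk:
  assumes "t \<noteq> u" "u \<noteq> v" "v \<noteq> w" "w \<noteq> t"
  shows "sym_diff {t, u} {u, v} = sym_diff {v, w} {w, t}"
proof (cases "t = v")
  case True
  then show ?thesis by (simp add: insert_commute)
next
  case False
  have "sym_diff {t, u} {u, v} = {t, v}" "sym_diff {v, w} {w, t} = {v, t}"
    using assms False by (simp_all add: insert_Diff_if insert_commute)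
  then show ?thesis by (simp add: insert_commute)
qed

lemma cycle_imp_balanced:
  assumes "a > 0" "b > 0" "c > 0" "d > 0" "cycle a b c d i j k l"
  shows "balanced a b c d i j k l"
proof -
  obtain v w where e: "edge b j (i + a) v" "edge c k v w" "edge d l w i"
    using assms(5) unfolding cycle_def by blast
  have "i \<noteq> i + a" "i + a \<noteq> v" "v \<noteq> w" "w \<noteq> i"
      using e assms(1-4) unfolding edge_def by auto
  note sym_diff_closed_walk[OF this]
  then show ?thesis
    unfolding balanced_def e[unfolded edge_iff] .
qed

text \<open>The alternatives overlap, because a cycle may degenerate into doubled edges.
  Disjointness is only arranged later, when positions are counted.\<close>

lemma balanced_iff:
  assumes "a > 0" "b > 0" "c > 0" "d > 0"
  shows "balanced a b c d i j k l \<longleftrightarrow>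
    i = j \<and> a = b \<and> k = l \<and> c = d \<or> i = k \<and> a = c \<and> j = l \<and> b = d
        \<or> i = l \<and> a = d \<and> j = k \<and> b = c \<or>
    cycle a b c d i j k l \<or> cycle a b d c i j l k \<or> cycle a c b d i k j l
        \<or> cycle a c d b i k l j \<or>
    cycle a d b c i l j k \<or> cycle a d c b i l k j" (is "_ \<longleftrightarrow> ?R")
proof
  show "balanced a b c d i j k l \<Longrightarrow> ?R" using assms by (rule balanced_cases)
  have pos: "x > 0" if "x \<in> {a, b, c, d}" for x
    using that assms by blast
  have cyc: "balanced x y z t p q r s"
    if "x \<in> {a, b, c, d}" "y \<in> {a, b, c, d}" "z \<in> {a, b, c, d}" "t \<in> {a, b, c, d}"
      "cycle x y z t p q r s" for x y z t p q r s
    using pos[OF that(1)] pos[OF that(2)] pos[OF that(3)] pos[OF that(4)] that(5)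
    by (rule cycle_imp_balanced)
  have pair: "balanced x x y y p p q q" "balanced x y x y p q p q" "balanced x y y x p q q p" for x y p q
    unfolding balanced_def by (simp, rule refl, rule Un_commute)
  assume ?R
  then consider "i = j \<and> a = b \<and> k = l \<and> c = d" | "i = k \<and> a = c \<and> j = l
      \<and> b = d"
    | "i = l \<and> a = d \<and> j = k \<and> b
        = c" | "cycle a b c d i j k l" | "cycle a b d c i j l k"
    | "cycle a c b d i k j l" | "cycle a c d b i k l j" | "cycle a d b c i l j k" | "cycle a d c b i l k j"
    by (elim disjE)
  then show "balanced a b c d i j k l"
  proof cases
    case 1 then show ?thesis by (simp only: pair)
  next
    case 2 then show ?thesis by (simp only: pair)
  next
    case 3 then show ?thesis by (simp only: pair)
  next
    case 4
    have "balanced a b c d i j k l" by (rule cyc[OF _ _ _ _ 4]) simp_all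
    then show ?thesis .
  next
    case 5
    have "balanced a b d c i j l k" by (rule cyc[OF _ _ _ _ 5]) simp_all
    then show ?thesis by (rule balanced_swap(4)[THEN iffD2])
  next
    case 6
    have "balanced a c b d i k j l" by (rule cyc[OF _ _ _ _ 6]) simp_all
    then show ?thesis by (rule balanced_swap(3)[THEN iffD2])
  next
    case 7
    have "balanced a c d b i k l j" by (rule cyc[OF _ _ _ _ 7]) simp_all
    then show ?thesis by (rule balanced_swap(3)[THEN iffD2, OF balanced_swap(4)[THEN iffD2]])
  next
    case 8
    have "balanced a d b c i l j k" by (rule cyc[OF _ _ _ _ 8]) simp_all
    then show ?thesis by (rule balanced_swap(4)[THEN iffD2, OF balanced_swap(3)[THEN iffD2]])
  next
    case 9
    have "balanced a d c b i l k j" by (rule cyc[OF _ _ _ _ 9]) simp_all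
    then show ?thesis
      by (rule balanced_swap(4)[THEN iffD2, OF balanced_swap(3)[THEN iffD2, OF balanced_swap(4)[THEN iffD2]]])
  qed
qed

text \<open>Three pairings and six orders with seven directions each make 45 linear alternatives.
  Once the pattern of the lengths is known, linear arithmetic discards or simplifies each of
  them.\<close>

lemma balanced_expand:
  assumes "a > 0" "b > 0" "c > 0" "d > 0"
  shows "balanced a b c d i j k l \<longleftrightarrow>
    i = j \<and> a = b \<and> k = l \<and> c = d \<or> i = k \<and> a = c \<and> j = l \<and> b = d
        \<or> i = l \<and> a = d \<and> j = k \<and> b = c \<or>
    a + b + c = d \<and> j = i + a \<and> k = j + b \<and> l = i \<or>
    a + b + d = c \<and> j = i + a \<and> i = l + d \<and> k = l \<or>
    a + c + d = b \<and> j + b = i + a \<and> k = j \<and> l = j + c \<or>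
    b + c + d = a \<and> j + b = i + a \<and> k + c = j \<and> l = i \<or>
    a + b = c + d \<and> j = i + a \<and> k = i + d \<and> l = i \<or>
    a + c = b + d \<and> j + b = i + a \<and> k = j \<and> l = i \<or>
    a + d = b + c \<and> j + b = i + a \<and> i = l + d \<and> k = l \<or>
    a + b + d = c \<and> j = i + a \<and> l = j + b \<and> k = i \<or>
    a + b + c = d \<and> j = i + a \<and> i = k + c \<and> l = k \<or>
    a + d + c = b \<and> j + b = i + a \<and> l = j \<and> k = j + d \<or>
    b + d + c = a \<and> j + b = i + a \<and> l + d = j \<and> k = i \<or>
    a + b = d + c \<and> j = i + a \<and> l = i + c \<and> k = i \<or>
    a + d = b + c \<and> j + b = i + a \<and> l = j \<and> k = i \<or>
    a + c = b + d \<and> j + b = i + a \<and> i = k + c \<and> l = k \<or>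
    a + c + b = d \<and> k = i + a \<and> j = k + c \<and> l = i \<or>
    a + c + d = b \<and> k = i + a \<and> i = l + d \<and> j = l \<or>
    a + b + d = c \<and> k + c = i + a \<and> j = k \<and> l = k + b \<or>
    c + b + d = a \<and> k + c = i + a \<and> j + b = k \<and> l = i \<or>
    a + c = b + d \<and> k = i + a \<and> j = i + d \<and> l = i \<or>
    a + b = c + d \<and> k + c = i + a \<and> j = k \<and> l = i \<or>
    a + d = c + b \<and> k + c = i + a \<and> i = l + d \<and> j = l \<or>
    a + c + d = b \<and> k = i + a \<and> l = k + c \<and> j = i \<or>
    a + c + b = d \<and> k = i + a \<and> i = j + b \<and> l = j \<or>
    a + d + b = c \<and> k + c = i + a \<and> l = k \<and> j = k + d \<or>
    c + d + b = a \<and> k + c = i + a \<and> l + d = k \<and> j = i \<or>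
    a + c = d + b \<and> k = i + a \<and> l = i + b \<and> j = i \<or>
    a + d = c + b \<and> k + c = i + a \<and> l = k \<and> j = i \<or>
    a + b = c + d \<and> k + c = i + a \<and> i = j + b \<and> l = j \<or>
    a + d + b = c \<and> l = i + a \<and> j = l + d \<and> k = i \<or>
    a + d + c = b \<and> l = i + a \<and> i = k + c \<and> j = k \<or>
    a + b + c = d \<and> l + d = i + a \<and> j = l \<and> k = l + b \<or>
    d + b + c = a \<and> l + d = i + a \<and> j + b = l \<and> k = i \<or>
    a + d = b + c \<and> l = i + a \<and> j = i + c \<and> k = i \<or>
    a + b = d + c \<and> l + d = i + a \<and> j = l \<and> k = i \<or>
    a + c = d + b \<and> l + d = i + a \<and> i = k + c \<and> j = k \<or>
    a + d + c = b \<and> l = i + a \<and> k = l + d \<and> j = i \<or>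
    a + d + b = c \<and> l = i + a \<and> i = j + b \<and> k = j \<or>
    a + c + b = d \<and> l + d = i + a \<and> k = l \<and> j = l + c \<or>
    d + c + b = a \<and> l + d = i + a \<and> k + c = l \<and> j = i \<or>
    a + d = c + b \<and> l = i + a \<and> k = i + b \<and> j = i \<or>
    a + c = d + b \<and> l + d = i + a \<and> k = l \<and> j = i \<or>
    a + b = d + c \<and> l + d = i + a \<and> i = j + b \<and> k = j"
  unfolding balanced_iff[OF assms(1-4)]
    cycle_iff[OF assms(1,2,3,4)] cycle_iff[OF assms(1,2,4,3)] cycle_iff[OF assms(1,3,2,4)]
    cycle_iff[OF assms(1,3,4,2)] cycle_iff[OF assms(1,4,2,3)] cycle_iff[OF assms(1,4,3,2)]
    disj_assoc
  by (rule refl)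

section \<open>Positions forced by the pattern of lengths\<close>

text \<open>The longest edge starts at \<open>l\<close>, and the other three are laid end to end
  along it, in any of six orders.\<close>

lemma balanced_sum:
  assumes "a > 0" "b > 0" "c > 0"
  shows "balanced a b c (a + b + c) i j k l \<longleftrightarrow>
     (i = l \<and> j = l + a \<and> k = l + a + b) \<or> (i = l \<and> k = l + a \<and> j = l + a
         + c) \<or>
     (j = l \<and> i = l + b \<and> k = l + a + b) \<or> (j = l \<and> k = l + b \<and> i = l + b
         + c) \<or>
     (k = l \<and> i = l + c \<and> j = l + a + c) \<or> (k = l \<and> j = l + c \<and> i = l + b
         + c)"
    (is "_ \<longleftrightarrow> ?R")
proof
  have d: "a + b + c > 0" using assms(1) by simp
  assume "balanced a b c (a + b + c) i j k l"
  from this[unfolded balanced_expand[OF assms d]] assms show ?R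
    by (elim disjE conjE) simp_all
next
  show "?R \<Longrightarrow> balanced a b c (a + b + c) i j k l" using assms
    by (elim disjE conjE) (simp_all add: balanced_expand)
qed

text \<open>Here \<open>a\<close> is the longest and \<open>b\<close> the shortest length, and
  \<open>c = d\<close> may occur. In four figures \<open>b\<close> extends \<open>a\<close> at the
  top or at the bottom, and \<open>c\<close> and \<open>d\<close> cover the same stretch end to end
  in either order. In the other two, \<open>c\<close> and \<open>d\<close> start from opposite ends
  of \<open>a\<close> and \<open>b\<close> is their overlap.\<close>

lemma balanced_sums:
  assumes "b > 0" "b < c" "b < d" "c < a" "d < a" "a + b = c + d"
  shows "balanced a b c d i j k l \<longleftrightarrow> (j = i + a \<and> k = i + d \<and> l = i)
      \<or> (j = i + a \<and> k = i \<and> l = i + c) \<or>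
     (i = j + b \<and> k = j + d \<and> l = j) \<or> (i = j + b \<and> k = j \<and> l = j + c) \<or>
     (j = k \<and> l = i \<and> k + c = i + a) \<or> (j = l \<and> k = i \<and> l + d = i + a)"
    (is "_ \<longleftrightarrow> ?R")
proof
  have pos: "a > 0" "b > 0" "c > 0" "d > 0" using assms by simp_all
  assume "balanced a b c d i j k l"
  from this[unfolded balanced_expand[OF pos]] assms show ?R
    by (elim disjE conjE) simp_all
next
  show "?R \<Longrightarrow> balanced a b c d i j k l" using assms
    by (elim disjE conjE) (simp_all add: balanced_expand)
qed

text \<open>Besides doubled edges there is the flattened parallelogram: two edges of length
  \<open>a\<close> shifted by \<open>b\<close> and two of length \<open>b\<close> shifted by
  \<open>a\<close>. Each pair can be listed in two orders.\<close>

lemma balanced_two: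
  assumes "a > 0" "b > 0" "a \<noteq> b"
  shows "balanced a a b b i j k l \<longleftrightarrow> (i = j \<and> k = l) \<or>
     (j = i + b \<and> k = i \<and> l = i + a) \<or> (j = i + b \<and> l = i \<and> k = i + a) \<or>
     (i = j + b \<and> k = j \<and> l = j + a) \<or> (i = j + b \<and> l = j \<and> k = j + a)"
    (is "_ \<longleftrightarrow> ?R")
proof
  assume "balanced a a b b i j k l"
  from this[unfolded balanced_expand[OF assms(1,1,2,2)]] assms show ?R
    by (elim disjE conjE) simp_all
next
  show "?R \<Longrightarrow> balanced a a b b i j k l" using assms
    by (elim disjE conjE) (simp_all add: balanced_expand)
qed

text \<open>Joining the points at distance \<open>a\<close> gives a graph without cycles, so a
  closed walk retraces its edges and only pairings remain.\<close>

lemma balanced_same: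
  assumes "a > 0"
  shows "balanced a a a a i j k l \<longleftrightarrow> (i = j \<and> k = l) \<or> (i = k \<and> j
      = l) \<or> (i = l \<and> j = k)"
  unfolding balanced_expand[OF assms assms assms assms] using assms by auto

text \<open>Around a closed walk the signed lengths add up to 0, and doubled edges satisfy an
  equation of the same kind.\<close>

lemma balanced_lengths:
  assumes "a > 0" "b > 0" "c > 0" "d > 0" "balanced a b c d i j k l"
  shows "a = b + c + d \<or> b = a + c + d \<or> c = a + b + d \<or> d = a + b + c \<or>
    a + b = c + d \<or> a + c = b + d \<or> a + d = b + c"
  using assms(5) unfolding balanced_expand[OF assms(1-4)]
  by (elim disjE conjE) simp_all

section \<open>Numbers of balanced positions\<close>

definition balanced_count :: "nat \<Rightarrow> nat \<Rightarrow> nat \<Rightarrow> nat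
    \<Rightarrow> nat \<Rightarrow> nat" where
  "balanced_count n a b c d = card {(i, j, k, l).
     i + a < n \<and> j + b < n \<and> k + c < n \<and> l + d < n \<and> balanced a b c d i j k l}"

lemma balanced_count_swap:
  "balanced_count n a b c d = balanced_count n b a c d"
  "balanced_count n a b c d = balanced_count n c d a b"
  "balanced_count n a b c d = balanced_count n a c b d"
proof -
  show "balanced_count n a b c d = balanced_count n b a c d"
    unfolding balanced_count_def
    by (rule bij_betw_same_card[of "\<lambda>(i, j, k, l). (j, i, k, l)"],
        rule bij_betw_byWitness[of _ "\<lambda>(i, j, k, l). (j, i, k, l)"])
       (auto simp: balanced_swap(1)[of a])
  show "balanced_count n a b c d = balanced_count n c d a b"
    unfolding balanced_count_def
    by (rule bij_betw_same_card[of "\<lambda>(i, j, k, l). (k, l, i, j)"],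
        rule bij_betw_byWitness[of _ "\<lambda>(i, j, k, l). (k, l, i, j)"])
       (auto simp: balanced_swap(2)[of a])
  show "balanced_count n a b c d = balanced_count n a c b d"
    unfolding balanced_count_def
    by (rule bij_betw_same_card[of "\<lambda>(i, j, k, l). (i, k, j, l)"],
        rule bij_betw_byWitness[of _ "\<lambda>(i, j, k, l). (i, k, j, l)"])
       (auto simp: balanced_swap(3)[of a])
qed

text \<open>A rigid figure moves only by a common shift of all its edges, so its positions form a
  line in direction (1, 1, 1, 1).\<close>

lemma card_line: "card ((\<lambda>x::nat. (x + p, x + q, x + r, x + s)) ` {..<m})
    = m" for p q r s :: nat
  by (subst card_image) (auto simp: inj_on_def)

lemma balanced_count_sum:
  assumes "a > 0" "b > 0" "c > 0"
  shows "balanced_count n a b c (a + b + c) = 6 * (n - (a + b + c))"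
proof -
  \<comment> \<open>The last offset is 0, so \<open>l\<close> itself is the parameter and lines with
    different offsets are disjoint.\<close>
  define L where "L p q r = (\<lambda>x. (x + p, x + q, x + r, x + 0)) ` {..<n - (a + b
      + c)}" for p q r :: nat
  have card_L: "card (L p q r) = n - (a + b + c)" for p q r unfolding L_def by (rule card_line)
  have fin: "finite (L p q r)" for p q r unfolding L_def by simp
  have mem: "(i, j, k, l) \<in> L p q r \<longleftrightarrow> l + (a + b + c) < n \<and> i = l + p
      \<and> j = l + q \<and> k = l + r"
    for i j k l p q r unfolding L_def by (auto simp: less_diff_conv)
  have "{(i, j, k, l). i + a < n \<and> j + b < n \<and> k + c < n \<and> l + (a + b + c) < n \<and>
            balanced a b c (a + b + c) i j k l} =
        L 0 a (a + b) \<union> (L 0 (a + c) a \<union> (L b 0 (a + b) \<union> (L (b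
            + c) 0 b \<union>
          (L c (a + c) 0 \<union> L (b + c) c 0))))" (is "?S = _")
  proof (rule set_eqI, clarify)
    fix i j k l
    show "(i, j, k, l) \<in> ?S \<longleftrightarrow> (i, j, k, l) \<in> L 0 a (a + b)
        \<union> (L 0 (a + c) a \<union> (L b 0 (a + b) \<union>
      (L (b + c) 0 b \<union> (L c (a + c) 0 \<union> L (b + c) c 0))))"
      unfolding mem_Collect_eq prod.case Un_iff mem balanced_sum[OF assms]
      by (intro iffI; elim conjE disjE) simp_all
  qed
  moreover have "L p q r \<inter> L p' q' r' = {}" if "p \<noteq> p' \<or> q \<noteq> q'
      \<or> r \<noteq> r'" for p q r p' q' r'
    using that unfolding L_def by auto
  ultimately show ?thesis
    unfolding balanced_count_def using assms
    by (simp add: card_Un_disjoint card_L fin Int_Un_distrib)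
qed

lemma balanced_count_sums:
  assumes "b > 0" "b < c" "b < d" "c < a" "d < a" "a + b = c + d"
  shows "balanced_count n a b c d = 2 * (n - a) + 4 * (n - (a + b))"
proof -
  \<comment> \<open>The span \<open>m\<close> is \<open>a + b\<close> if \<open>b\<close> sticks out
    of \<open>a\<close>, and \<open>a\<close> if it lies inside. The parameter is the lowest point
    of the figure, which is \<open>i\<close> or \<open>j\<close>; hence the two forms of membership
    below.\<close>
  define L where "L m p q r s = (\<lambda>x. (x + p, x + q, x + r, x + s)) ` {..<n
      - m}" for m p q r s :: nat
  have card_L: "card (L m p q r s) = n - m" for m p q r s unfolding L_def by (rule card_line)
  have fin: "finite (L m p q r s)" for m p q r s unfolding L_def by simp
  have mem: "(i, j, k, l) \<in> L m 0 q r s \<longleftrightarrow> i + m < n \<and> j = i + q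
      \<and> k = i + r \<and> l = i + s"
    "(i, j, k, l) \<in> L m p 0 r s \<longleftrightarrow> j + m < n \<and> i = j + p \<and> k = j
        + r \<and> l = j + s"
    for i j k l m p q r s unfolding L_def by (auto simp: less_diff_conv)
  have "{(i, j, k, l). i + a < n \<and> j + b < n \<and> k + c < n \<and> l + d < n
      \<and> balanced a b c d i j k l} =
        L (a + b) 0 a d 0 \<union> (L (a + b) 0 a 0 c \<union> (L (a + b) b 0 d 0 \<union> (L (a
            + b) b 0 0 c \<union>
          (L a 0 (a - c) (a - c) 0 \<union> L a 0 (a - d) 0 (a - d)))))" (is "?S = ?T")
  proof (rule set_eqI, clarify)
    fix i j k l
    show "(i, j, k, l) \<in> ?S \<longleftrightarrow> (i, j, k, l) \<in> ?T"
      unfolding mem_Collect_eq prod.case Un_iff mem balanced_sums[OF assms] using assms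
      by (intro iffI; elim conjE disjE) simp_all
  qed
  moreover have "L (a + b) 0 a d 0 \<inter> (L (a + b) 0 a 0 c \<union> (L (a + b) b 0 d 0
      \<union> (L (a + b) b 0 0 c \<union>
          (L a 0 (a - c) (a - c) 0 \<union> L a 0 (a - d) 0 (a - d))))) = {}"
    "L (a + b) 0 a 0 c \<inter> (L (a + b) b 0 d 0 \<union> (L (a + b) b 0 0 c \<union>
          (L a 0 (a - c) (a - c) 0 \<union> L a 0 (a - d) 0 (a - d)))) = {}"
    "L (a + b) b 0 d 0 \<inter> (L (a + b) b 0 0 c \<union>
          (L a 0 (a - c) (a - c) 0 \<union> L a 0 (a - d) 0 (a - d))) = {}"
    "L (a + b) b 0 0 c \<inter> (L a 0 (a - c) (a - c) 0 \<union> L a 0 (a - d) 0 (a - d)) = {}"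
    "L a 0 (a - c) (a - c) 0 \<inter> L a 0 (a - d) 0 (a - d) = {}"
    using assms unfolding L_def by auto
  ultimately show ?thesis
    unfolding balanced_count_def by (simp add: card_Un_disjoint card_L fin)
qed

lemma balanced_count_two:
  assumes "a > 0" "b > 0" "a \<noteq> b"
  shows "balanced_count n a a b b = (n - a) * (n - b) + 4 * (n - (a + b))"
proof -
  define L where "L p q r s = (\<lambda>x. (x + p, x + q, x + r, x + s)) ` {..<n - (a
      + b)}" for p q r s :: nat
  have card_L: "card (L p q r s) = n - (a + b)" for p q r s unfolding L_def by (rule card_line)
  have fin: "finite (L p q r s)" for p q r s unfolding L_def by simp
  have mem: "(i, j, k, l) \<in> L 0 q r s \<longleftrightarrow> i + (a + b) < n \<and> j = i + q
      \<and> k = i + r \<and> l = i + s"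
    "(i, j, k, l) \<in> L p 0 r s \<longleftrightarrow> j + (a + b) < n \<and> i = j + p \<and> k
        = j + r \<and> l = j + s"
    for i j k l p q r s unfolding L_def by (auto simp: less_diff_conv)
  \<comment> \<open>Doubled edges have two independent positions, whence the product in the
    count.\<close>
  define P where "P = (\<lambda>(x, y). (x, x, y, y)) ` ({..<n - a} \<times> {..<n - b})"
  have card_P: "card P = (n - a) * (n - b)"
    unfolding P_def by (subst card_image) (auto simp: inj_on_def)
  have finP: "finite P" unfolding P_def by simp
  have memP: "(i, j, k, l) \<in> P \<longleftrightarrow> i + a < n \<and> i = j \<and> k + b < n
      \<and> k = l" for i j k l
    unfolding P_def by (auto simp: less_diff_conv)
  have "{(i, j, k, l). i + a < n \<and> j + a < n \<and> k + b < n \<and> l + b < n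
      \<and> balanced a a b b i j k l} =
        P \<union> (L 0 b 0 a \<union> (L 0 b a 0 \<union> (L b 0 0 a \<union> L b 0 a 0)))" (is "?S
            = ?T")
  proof (rule set_eqI, clarify)
    fix i j k l
    show "(i, j, k, l) \<in> ?S \<longleftrightarrow> (i, j, k, l) \<in> ?T"
      unfolding mem_Collect_eq prod.case Un_iff mem memP balanced_two[OF assms]
      by (intro iffI; elim conjE disjE) simp_all
  qed
  \<comment> \<open>Along a line the differences of neighbouring coordinates are constant, so lines
    that differ in one of them do not meet.\<close>
  moreover have "L p q r s \<inter> L p' q' r' s' = {}"
    if "p + q' \<noteq> p' + q \<or> q + r' \<noteq> q' + r \<or> r + s' \<noteq> r'
        + s" for p q r s p' q' r' s'
    using that unfolding L_def by auto
  moreover have "P \<inter> L p q r s = {}" if "p \<noteq> q" for p q r s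
    using that unfolding L_def P_def by auto
  ultimately show ?thesis
    unfolding balanced_count_def using assms
    by (simp add: card_Un_disjoint card_L fin Int_Un_distrib card_P finP)
qed

lemma balanced_count_same:
  assumes "a > 0"
  shows "real (balanced_count n a a a a) = 3 * real (n - a) ^ 2 - 2 * real (n - a)"
proof -
  \<comment> \<open>Four equal positions fit all three pairings. They are counted in
    \<open>?P\<close> only and \<open>?D\<close> removes them from the other two, which gives 3 m^2
    - 2 m with m = \<open>n - a\<close>.\<close>
  let ?I = "{..<n - a}" and ?D = "{(x, y). x < n - a \<and> y < n - a \<and> x \<noteq> y}"
  let ?P = "(\<lambda>(x, y). (x, x, y, y)) ` (?I \<times> ?I)"
    and ?Q = "(\<lambda>(x, y). (x, y, x, y)) ` ?D" and ?R = "(\<lambda>(x, y). (x, y, y, x)) ` ?D"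
  have S: "{(i, j, k, l). i + a < n \<and> j + a < n \<and> k + a < n \<and> l + a < n
      \<and> balanced a a a a i j k l} =
    ?P \<union> (?Q \<union> ?R)" (is "?S = ?T")
  proof (rule set_eqI, clarify)
    fix i j k l
    show "(i, j, k, l) \<in> ?S \<longleftrightarrow> (i, j, k, l) \<in> ?T"
      unfolding mem_Collect_eq prod.case balanced_same[OF assms]
      by (auto simp: image_iff less_diff_conv)
  qed
  have sub: "?D = ?I \<times> ?I - (\<lambda>x. (x, x)) ` ?I" by auto
  have "card ((\<lambda>x. (x, x)) ` ?I) = n - a" by (subst card_image) (auto simp: inj_on_def)
  then have D: "card ?D = (n - a) * (n - a) - (n - a)"
    unfolding sub by (subst card_Diff_subset) auto
  have finD: "finite ?D" unfolding sub by simp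
  have "card ?P = (n - a) * (n - a)" by (subst card_image) (auto simp: inj_on_def)
  moreover have "card ?Q = card ?D" "card ?R = card ?D"
    by (auto intro!: card_image simp: inj_on_def)
  moreover have "?P \<inter> (?Q \<union> ?R) = {}" "?Q \<inter> ?R = {}" by auto
  ultimately have "card (?P \<union> (?Q \<union> ?R)) = (n - a) * (n - a) + 2 * ((n - a) * (n - a)
      - (n - a))"
    using finD D by (simp add: card_Un_disjoint)
  moreover have "n - a \<le> (n - a) * (n - a)" by (cases "n - a") auto
  ultimately show ?thesis
    unfolding balanced_count_def S by (simp add: of_nat_diff power2_eq_square)
qed

lemma balanced_count_eq_0:
  assumes "a > 0" "b > 0" "c > 0" "d > 0"
    and "\<not> (a = b + c + d \<or> b = a + c + d \<or> c = a + b + d \<or> d = a + b + c \<or>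
    a + b = c + d \<or> a + c = b + d \<or> a + d = b + c)"
  shows "balanced_count n a b c d = 0"
proof -
  have "{(i, j, k, l). i + a < n \<and> j + b < n \<and> k + c < n \<and> l + d < n
      \<and> balanced a b c d i j k l} = {}"
    using balanced_lengths[OF assms(1-4)] assms(5) by blast
  then show ?thesis unfolding balanced_count_def by (simp only: card.empty)
qed

section \<open>From the demerit factor to edge counts\<close>

definition autocorr :: "nat \<Rightarrow> (nat \<Rightarrow> real) \<Rightarrow> nat
    \<Rightarrow> real" where
  "autocorr n x s = (\<Sum>j<n - s. x j * x (j + s))"

definition re_seq :: "(int \<Rightarrow> complex) \<Rightarrow> nat \<Rightarrow> real" where
  "re_seq f j = Re (f (int j))"

text \<open>A common form for correlations at signed shifts: the choice
  \<open>u i j = x i * y j\<close> is a crosscorrelation and \<open>u i j = x i * x j\<close> an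
  autocorrelation.\<close>

definition diff_sum :: "nat \<Rightarrow> (nat \<Rightarrow> nat \<Rightarrow> real)
    \<Rightarrow> int \<Rightarrow> real" where
  "diff_sum n u t = (\<Sum>i<n. \<Sum>j<n. if int i - int j = t then u i j else 0)"

lemma diff_sum_alt:
  "diff_sum n u t = (\<Sum>p\<in>{..<n} \<times> {..<n}. if int (fst p) - int (snd p)
      = t then u (fst p) (snd p) else 0)"
  unfolding diff_sum_def sum.cartesian_product by (simp add: case_prod_beta)

text \<open>All differences of indices below \<open>n\<close> lie in the range of \<open>t\<close>,
  so summing over \<open>t\<close> only leaves the condition that the two differences agree.\<close>

lemma sum_diff_sum_mult:
  "(\<Sum>t\<in>{- int n..int n}. diff_sum n u t * diff_sum n v t) =
   (\<Sum>i<n. \<Sum>j<n. \<Sum>k<n. \<Sum>m<n. if int i - int j = int k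
       - int m then u i j * v k m else 0)"
proof -
  let ?P = "{..<n} \<times> {..<n}"
  let ?D = "\<lambda>p::nat \<times> nat. int (fst p) - int (snd p)"
  have "(\<Sum>t\<in>{- int n..int n}. diff_sum n u t * diff_sum n v t) =
    (\<Sum>t\<in>{- int n..int n}. \<Sum>p\<in>?P. \<Sum>q\<in>?P.
       (if ?D p = t then if ?D p = ?D q then u (fst p) (snd p) * v (fst q) (snd q) else 0 else 0))"
    unfolding diff_sum_alt sum_product by (intro sum.cong refl) auto
  also have "\<dots> = (\<Sum>p\<in>?P. \<Sum>q\<in>?P. \<Sum>t\<in>{- int n..int n}.
       (if ?D p = t then if ?D p = ?D q then u (fst p) (snd p) * v (fst q) (snd q) else 0 else 0))"
    by (subst sum.swap, rule sum.cong[OF refl], subst sum.swap, rule refl)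
  also have "\<dots> = (\<Sum>p\<in>?P. \<Sum>q\<in>?P. if ?D p
      = ?D q then u (fst p) (snd p) * v (fst q) (snd q) else 0)"
    by (intro sum.cong refl) (auto simp: sum.delta)
  also have "\<dots> = (\<Sum>i<n. \<Sum>j<n. \<Sum>k<n. \<Sum>m<n. if int i - int j = int k
      - int m then u i j * v k m else 0)"
    unfolding sum.cartesian_product' fst_conv snd_conv by (rule refl)
  finally show ?thesis .
qed

text \<open>Both sides sum over $i - j = k - m$, which is the same condition as $i - k = j
    - m$.\<close>

lemma sum_diff_sum_exchange:
  "(\<Sum>t\<in>{- int n..int n}. (diff_sum n (\<lambda>i j. x i * y j) t)\<^sup>2) =
   (\<Sum>t\<in>{- int n..int n}. diff_sum n (\<lambda>i j. x i * x j) t * diff_sum n (\<lambda>i j. y i * y j) t)"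
  unfolding power2_eq_square sum_diff_sum_mult
  by (rule sum.cong[OF refl], subst sum.swap, intro sum.cong refl) (auto simp: algebra_simps)

lemma diff_sum_uminus:
  "diff_sum n (\<lambda>i j. x i * x j) (- t) = diff_sum n (\<lambda>i j. x i * x j) t"
  unfolding diff_sum_def by (subst sum.swap, intro sum.cong refl) auto

lemma diff_sum_of_nat: "diff_sum n (\<lambda>i j. x i * x j) (int s) = autocorr n x s"
proof -
  have "diff_sum n (\<lambda>i j. x i * x j) (int s) = (\<Sum>j<n. \<Sum>i<n. if i = j
      + s then x i * x j else 0)"
    unfolding diff_sum_def by (subst sum.swap, intro sum.cong refl) auto
  also have "\<dots> = (\<Sum>j<n. if j + s < n then x (j + s) * x j else 0)"
    by (intro sum.cong refl) (auto simp: sum.delta)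
  also have "\<dots> = (\<Sum>j<n - s. x j * x (j + s))"
    by (rule sum.mono_neutral_cong_right) auto
  finally show ?thesis unfolding autocorr_def .
qed

lemma sum_diff_sum_eq_autocorr:
  "(\<Sum>t\<in>{- int n..int n}. diff_sum n (\<lambda>i j. x i * x j) t * diff_sum n (\<lambda>i j. y i * y j) t) =
     autocorr n x 0 * autocorr n y 0 + 2 * (\<Sum>s\<in>{1..<n}. autocorr n x s * autocorr n y s)"
proof -
  let ?B
      = "\<lambda>t. diff_sum n (\<lambda>i j. x i * x j) t * diff_sum n (\<lambda>i j. y i * y j) t"
  have "{- int n..int n} = insert 0 (int ` {1..n} \<union> (\<lambda>s. - int s) ` {1..n})"
  proof (intro set_eqI iffI)
    fix t assume t: "t \<in> {- int n..int n}"
    have "t = 0 \<or> t = int (nat t) \<and> nat t \<in> {1..n} \<or> t = - int (nat (- t))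
        \<and> nat (- t) \<in> {1..n}"
      using t by auto
    then show "t \<in> insert 0 (int ` {1..n} \<union> (\<lambda>s. - int s) ` {1..n})" by blast
  qed auto
  then have "sum ?B {- int n..int n} = ?B 0 + (sum ?B (int ` {1..n}) + sum ?B ((\<lambda>s.
      - int s) ` {1..n}))"
    by (simp only:) (subst sum.insert, auto intro!: sum.union_disjoint)
  also have "sum ?B (int ` {1..n}) = (\<Sum>s\<in>{1..n}. autocorr n x s * autocorr n y s)"
    by (subst sum.reindex) (auto simp: diff_sum_of_nat)
  also have "sum ?B ((\<lambda>s. - int s) ` {1..n})
      = (\<Sum>s\<in>{1..n}. autocorr n x s * autocorr n y s)"
    by (subst sum.reindex) (auto simp: diff_sum_of_nat diff_sum_uminus inj_on_def)
  also have "?B 0 = autocorr n x 0 * autocorr n y 0"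
    using diff_sum_of_nat[of n _ 0] by simp
  also have "(\<Sum>s\<in>{1..n}. autocorr n x s * autocorr n y s)
      = (\<Sum>s\<in>{1..<n}. autocorr n x s * autocorr n y s)"
    by (rule sum.mono_neutral_right) (auto simp: autocorr_def)
  finally show ?thesis by simp
qed

lemma re_seq_binary:
  assumes "f \<in> binary_seqs l" "j < l"
  shows "re_seq f j = 1 \<or> re_seq f j = -1"
proof -
  have "0 \<le> int j \<and> int j \<le> int l - 1" using assms(2) by auto
  then have "f (int j) \<in> {-1, 1}" using assms(1) unfolding binary_seqs_def by blast
  then show ?thesis unfolding re_seq_def by auto
qed

text \<open>Writing a value as a sum of point masses builds in the zeros outside the support, so
  shifted arguments need no case distinction.\<close>

lemma binary_seqs_eq_re_seq:
  assumes "f \<in> binary_seqs l"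
  shows "f t = (\<Sum>i<l. if int i = t then of_real (re_seq f i) else 0)"
proof (cases "0 \<le> t \<and> t \<le> int l - 1")
  case True
  then have t: "t = int (nat t)" "nat t < l" by auto
  have "f t \<in> {-1, 1}" using True assms unfolding binary_seqs_def by blast
  then have "f t = of_real (re_seq f (nat t))" using t(1) unfolding re_seq_def by auto
  also have "\<dots> = (\<Sum>i<l. if i = nat t then of_real (re_seq f i) else 0)"
    using t(2) by (simp add: sum.delta)
  also have "\<dots> = (\<Sum>i<l. if int i = t then of_real (re_seq f i) else 0)"
    by (intro sum.cong refl) (use True in auto)
  finally show ?thesis .
next
  case False
  then have "f t = 0" using assms unfolding binary_seqs_def by blast
  moreover have "(\<Sum>i<l. if int i = t then complex_of_real (re_seq f i) else 0) = 0"
    by (intro sum.neutral) (use False in auto)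
  ultimately show ?thesis by simp
qed

lemma crosscorr_eq_diff_sum:
  assumes f: "f \<in> binary_seqs l" and g: "g \<in> binary_seqs l"
  shows "crosscorr f g s = of_real (diff_sum l (\<lambda>i j. re_seq f i * re_seq g j) s)"
proof -
  have supp: "{j. f (j + s) * cnj (g j) \<noteq> 0} \<subseteq> int ` {..<l}"
  proof
    fix j assume "j \<in> {j. f (j + s) * cnj (g j) \<noteq> 0}"
    then have "g j \<noteq> 0" by auto
    then have "0 \<le> j \<and> j \<le> int l - 1" using g unfolding binary_seqs_def by blast
    then have "j = int (nat j)" "nat j < l" by auto
    then show "j \<in> int ` {..<l}" by blast
  qed
  have "crosscorr f g s = (\<Sum>j\<in>int ` {..<l}. f (j + s) * cnj (g j))"
    unfolding crosscorr_def by (rule Sum_any.expand_superset) (use supp in auto)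
  also have "\<dots> = (\<Sum>j<l. f (int j + s) * cnj (g (int j)))"
    by (subst sum.reindex) auto
  also have "\<dots> = (\<Sum>j<l. \<Sum>i<l. if int i - int j
      = s then of_real (re_seq f i * re_seq g j) else 0)"
  proof (intro sum.cong refl)
    fix j assume "j \<in> {..<l}"
    then have "g (int j) = of_real (re_seq g j)"
      by (subst binary_seqs_eq_re_seq[OF g]) (simp add: sum.delta)
    then show "f (int j + s) * cnj (g (int j)) =
        (\<Sum>i<l. if int i - int j = s then of_real (re_seq f i * re_seq g j) else 0)"
      by (subst binary_seqs_eq_re_seq[OF f]) (auto simp: sum_distrib_right intro!: sum.cong)
  qed
  also have "\<dots> = of_real (diff_sum l (\<lambda>i j. re_seq f i * re_seq g j) s)"
    unfolding diff_sum_def by (subst sum.swap) (simp add: of_real_sum if_distrib cong: if_cong)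
  finally show ?thesis .
qed

lemma autocorr_0_binary:
  assumes "f \<in> binary_seqs l"
  shows "autocorr l (re_seq f) 0 = real l"
proof -
  have "autocorr l (re_seq f) 0 = (\<Sum>j<l. 1)"
    unfolding autocorr_def by (rule sum.cong) (use re_seq_binary[OF assms] in force)+
  then show ?thesis by simp
qed

text \<open>The denominator \<open>l\<close> squared is also what shift 0 contributes to the
  numerator; this is the summand 1.\<close>

lemma CDF_eq:
  assumes f: "f \<in> binary_seqs l" and g: "g \<in> binary_seqs l" and l: "l > 0"
  shows "CDF f g = 1 + 2 / real l ^ 2 *
     (\<Sum>s\<in>{1..<l}. autocorr l (re_seq f) s * autocorr l (re_seq g) s)"
proof -
  let ?x = "re_seq f" and ?y = "re_seq g"
  let ?c = "diff_sum l (\<lambda>i j. ?x i * ?y j)"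
  have "?c s = 0" if "s \<notin> {- int l..int l}" for s
    unfolding diff_sum_def by (intro sum.neutral ballI) (use that in auto)
  then have "{s. (?c s)\<^sup>2 \<noteq> 0} \<subseteq> {- int l..int l}"
    by (metis (mono_tags, lifting) mem_Collect_eq subsetI zero_power2)
  then have "Sum_any (\<lambda>s. (cmod (crosscorr f g s))\<^sup>2)
      = (\<Sum>s\<in>{- int l..int l}. (?c s)\<^sup>2)"
    unfolding crosscorr_eq_diff_sum[OF f g] norm_of_real power2_abs
    by (intro Sum_any.expand_superset) simp_all
  also have "\<dots> = real l * real l
      + 2 * (\<Sum>s\<in>{1..<l}. autocorr l ?x s * autocorr l ?y s)"
    unfolding sum_diff_sum_exchange sum_diff_sum_eq_autocorr
    by (simp only: autocorr_0_binary[OF f] autocorr_0_binary[OF g])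
  finally have num: "Sum_any (\<lambda>s. (cmod (crosscorr f g s))\<^sup>2) =
    real l * real l + 2 * (\<Sum>s\<in>{1..<l}. autocorr l ?x s * autocorr l ?y s)" .
  have "Re (crosscorr h h 0) = real l" if "h \<in> binary_seqs l" for h
    unfolding crosscorr_eq_diff_sum[OF that that] Re_complex_of_real
    using diff_sum_of_nat[of l "re_seq h" 0] autocorr_0_binary[OF that] by simp
  then show ?thesis
    unfolding CDF_def num using l f g by (simp add: field_simps power2_eq_square)
qed

section \<open>Averages of products of random signs\<close>

lemma prod_sym_diff:
  fixes x :: "'a \<Rightarrow> real"
  assumes "finite K" "finite L" "\<And>k. k \<in> K \<inter> L \<Longrightarrow> x k * x k = 1"
  shows "prod x K * prod x L = prod x (sym_diff K L)"
proof -
  have "prod x K = prod x (K - L) * prod x (K \<inter> L)"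
    by (metis assms(1) prod.Int_Diff mult.commute)
  moreover have "prod x L = prod x (L - K) * prod x (K \<inter> L)"
    by (metis assms(2) prod.Int_Diff mult.commute Int_commute)
  moreover have "prod x (K \<inter> L) * prod x (K \<inter> L) = 1"
    using assms(3) by (simp add: prod.distrib[symmetric])
  moreover have "prod x (sym_diff K L) = prod x (K - L) * prod x (L - K)"
    by (rule prod.union_disjoint) (use assms in auto)
  ultimately show ?thesis by algebra
qed

text \<open>Reversing the sign at a point of \<open>K\<close> permutes the sequences and negates the
  product, so the sum is its own negative. This is the orthogonality of the characters of the group
  of sign vectors.\<close>

lemma sum_prod_binary_seqs:
  assumes "K \<subseteq> {..<l}"
  shows "(\<Sum>f\<in>binary_seqs l. prod (re_seq f) K) = (if K = {} then 2 ^ l else 0)"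
proof (cases "K = {}")
  case True
  then show ?thesis by (simp add: card_binary_seqs)
next
  case False
  then obtain k where k: "k \<in> K" by blast
  have finK: "finite K" using assms finite_subset by blast
  let ?flip = "\<lambda>f. f(int k := - f (int k))"
  have k': "0 \<le> int k \<and> int k \<le> int l - 1" using k assms by auto
  have flip: "?flip f \<in> binary_seqs l" if f: "f \<in> binary_seqs l" for f
  proof -
    have "f (int k) \<in> {-1, 1}" using f k' unfolding binary_seqs_def by blast
    then have "- f (int k) \<in> {-1, 1}" by auto
    with k' show ?thesis using f unfolding binary_seqs_def by simp
  qed
  have prod: "- prod (re_seq (?flip f)) K = prod (re_seq f) K" for f
  proof -
    have "prod (re_seq (?flip f)) (K - {k}) = prod (re_seq f) (K - {k})"
      by (rule prod.cong) (auto simp: re_seq_def)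
    then show ?thesis using k finK by (simp add: prod.remove re_seq_def)
  qed
  have "(\<Sum>f\<in>binary_seqs l. prod (re_seq f) K) = (\<Sum>f\<in>binary_seqs l.
      - prod (re_seq f) K)"
    by (rule sum.reindex_bij_witness[of _ ?flip ?flip]) (simp_all add: flip prod)
  also have "\<dots> = - (\<Sum>f\<in>binary_seqs l. prod (re_seq f) K)" by (rule sum_negf)
  finally show ?thesis using False by simp
qed

text \<open>At shift 0 the two points would coincide and the product would lose a factor.\<close>

lemma autocorr_eq_sum_prod:
  assumes "s > 0"
  shows "autocorr n x s = (\<Sum>j<n - s. prod x {j, j + s})"
  unfolding autocorr_def using assms by simp

lemma sum_autocorr_binary_seqs:
  assumes "s > 0"
  shows "(\<Sum>f\<in>binary_seqs l. autocorr l (re_seq f) s) = 0"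
proof -
  have "(\<Sum>f\<in>binary_seqs l. autocorr l (re_seq f) s) =
      (\<Sum>j<l - s. \<Sum>f\<in>binary_seqs l. prod (re_seq f) {j, j + s})"
    unfolding autocorr_eq_sum_prod[OF assms] by (rule sum.swap)
  also have "\<dots> = 0"
  proof (rule sum.neutral, rule ballI)
    fix j assume "j \<in> {..<l - s}"
    then have "{j, j + s} \<subseteq> {..<l}" by auto
    then show "(\<Sum>f\<in>binary_seqs l. prod (re_seq f) {j, j + s}) = 0"
      by (subst sum_prod_binary_seqs) auto
  qed
  finally show ?thesis .
qed

text \<open>Signs at points met an even number of times cancel, and the points of odd degree
  remain.\<close>

lemma prod_four_edges:
  assumes f: "f \<in> binary_seqs l"
      and "A \<subseteq> {..<l}" "B \<subseteq> {..<l}" "C \<subseteq> {..<l}" "D \<subseteq> {..<l}"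
  shows "prod (re_seq f) A * prod (re_seq f) B * (prod (re_seq f) C * prod (re_seq f) D) =
    prod (re_seq f) (sym_diff (sym_diff A B) (sym_diff C D))"
proof -
  have sq: "re_seq f k * re_seq f k = 1" if "k < l" for k using re_seq_binary[OF f that] by auto
  have mult: "prod (re_seq f) K * prod (re_seq f) L = prod (re_seq f) (sym_diff K L)"
    if "K \<subseteq> {..<l}" "L \<subseteq> {..<l}" for K L
    by (rule prod_sym_diff) (use that sq finite_subset[OF _ finite_lessThan] in auto)
  have sub: "sym_diff K L \<subseteq> {..<l}" if "K \<subseteq> {..<l}" "L \<subseteq> {..<l}" for K L
    using that by auto
  show ?thesis
    unfolding mult[OF assms(2,3)] mult[OF assms(4,5)] by (intro mult sub assms)
qed

lemma sum_product4:
  fixes F G H K :: "'a \<Rightarrow> 'b :: semiring_0"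
  shows "sum F A * sum G B * (sum H C * sum K D) =
    (\<Sum>a\<in>A. \<Sum>b\<in>B. \<Sum>c\<in>C. \<Sum>d\<in>D. F a * G b * (H c * K d))"
  by (simp only: sum_product[of F A G B] sum_product[of H C K D], simp only: sum_distrib_right,
      simp only: sum_distrib_left)

lemma sum_power4:
  fixes F :: "'a \<Rightarrow> 'b :: comm_semiring_1"
  shows "sum F A ^ 4
      = (\<Sum>a\<in>A. \<Sum>b\<in>A. \<Sum>c\<in>A. \<Sum>d\<in>A. F a * F b * (F c * F d))"
  unfolding sum_product4[symmetric] by (simp add: power4_eq_xxxx mult.assoc)

text \<open>Each choice of four positions contributes \<open>2 ^ l\<close> if no point has odd
  degree, and 0 otherwise.\<close>

lemma sum_autocorr4_binary_seqs:
  assumes "a > 0" "b > 0" "c > 0" "d > 0"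
  shows "(\<Sum>f\<in>binary_seqs l. autocorr l (re_seq f) a * autocorr l (re_seq f) b *
     (autocorr l (re_seq f) c * autocorr l (re_seq f) d)) = 2 ^ l * real (balanced_count l a b c d)"
proof -
  let ?J = "{..<l - a} \<times> {..<l - b} \<times> {..<l - c} \<times> {..<l - d}"
  let ?bal = "\<lambda>(i, j, k, m). balanced a b c d i j k m"
  have "(\<Sum>f\<in>binary_seqs l. autocorr l (re_seq f) a * autocorr l (re_seq f) b *
     (autocorr l (re_seq f) c * autocorr l (re_seq f) d)) =
    (\<Sum>f\<in>binary_seqs l. \<Sum>(i, j, k, m)\<in>?J.
       prod (re_seq f) {i, i + a} * prod (re_seq f) {j, j + b} *
       (prod (re_seq f) {k, k + c} * prod (re_seq f) {m, m + d}))"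
    unfolding autocorr_eq_sum_prod[OF assms(1)] autocorr_eq_sum_prod[OF assms(2)]
      autocorr_eq_sum_prod[OF assms(3)] autocorr_eq_sum_prod[OF assms(4)]
      sum_product4 sum.cartesian_product ..
  also have "\<dots>
      = (\<Sum>p\<in>?J. \<Sum>f\<in>binary_seqs l. case p of (i, j, k, m) \<Rightarrow>
       prod (re_seq f) {i, i + a} * prod (re_seq f) {j, j + b} *
       (prod (re_seq f) {k, k + c} * prod (re_seq f) {m, m + d}))"
    by (rule sum.swap)
  also have "\<dots> = (\<Sum>p\<in>?J. if ?bal p then 2 ^ l else 0)"
  proof (rule sum.cong[OF refl])
    fix p assume p: "p \<in> ?J"
    obtain i j k m where pe: "p = (i, j, k, m)" by (cases p)
    have sub: "{i, i + a} \<subseteq> {..<l}" "{j, j + b} \<subseteq> {..<l}" "{k, k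
        + c} \<subseteq> {..<l}" "{m, m + d} \<subseteq> {..<l}"
      using p unfolding pe by auto
    let ?S = "sym_diff (sym_diff {i, i + a} {j, j + b}) (sym_diff {k, k + c} {m, m + d})"
    have S: "?S \<subseteq> {..<l}" using sub by blast
    have "?S = {} \<longleftrightarrow> ?bal p"
      unfolding pe prod.case balanced_def by (rule iffI, erule sym_diff_empty, simp)
    moreover have "(\<Sum>f\<in>binary_seqs l. prod (re_seq f) {i, i + a} * prod (re_seq f) {j, j
        + b} *
       (prod (re_seq f) {k, k + c} * prod (re_seq f) {m, m + d}))
           = (\<Sum>f\<in>binary_seqs l. prod (re_seq f) ?S)"
      by (intro sum.cong refl prod_four_edges) (use sub in simp_all)
    ultimately show "(\<Sum>f\<in>binary_seqs l. case p of (i, j, k, m) \<Rightarrow>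
       prod (re_seq f) {i, i + a} * prod (re_seq f) {j, j + b} *
       (prod (re_seq f) {k, k + c} * prod (re_seq f) {m, m + d})) = (if ?bal p then 2 ^ l else 0)"
      unfolding pe prod.case by (simp only: sum_prod_binary_seqs[OF S])
  qed
  also have "\<dots> = 2 ^ l * real (card {p \<in> ?J. ?bal p})"
    by (simp add: sum.inter_filter[symmetric])
  also have "{p \<in> ?J. ?bal p} = {(i, j, k, m).
     i + a < l \<and> j + b < l \<and> k + c < l \<and> m + d < l \<and> balanced a b c d i j k m}"
    by (auto simp: less_diff_conv)
  finally show ?thesis unfolding balanced_count_def .
qed

section \<open>Moments over pairs of sequences\<close>

lemma Pair_expectation_eq:
  "Pair_expectation l v = (\<Sum>p\<in>Pair_set l. v p) / 4 ^ l"
  unfolding Pair_expectation_def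
  by (subst integral_pmf_of_set) (simp_all add: finite_Pair_set Pair_set_nonempty card_Pair_set power_mult)

text \<open>With \<open>f\<close> fixed, the sum over \<open>g\<close> already annihilates every
  positive shift.\<close>

lemma Pair_expectation_CDF:
  assumes "l > 0"
  shows "Pair_expectation l (\<lambda>(f, g). CDF f g) = 1"
proof -
  have "(\<Sum>p\<in>Pair_set l. case p of (f, g) \<Rightarrow> CDF f g)
      = (\<Sum>f\<in>binary_seqs l. \<Sum>g\<in>binary_seqs l. CDF f g)"
    unfolding Pair_set_def by (rule sum.cartesian_product[symmetric])
  also have "\<dots> = (\<Sum>f\<in>binary_seqs l. \<Sum>g\<in>binary_seqs l. 1 + 2 / real l ^ 2 *
      (\<Sum>s\<in>{1..<l}. autocorr l (re_seq f) s * autocorr l (re_seq g) s))"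
    by (intro sum.cong refl CDF_eq assms)
  also have "\<dots> = 2 ^ l * 2 ^ l + 2 / real l ^ 2 *
      (\<Sum>f\<in>binary_seqs l. \<Sum>g\<in>binary_seqs l. \<Sum>s\<in>{1..<l}. autocorr l (re_seq f) s * autocorr l (re_seq g) s)"
    by (simp add: sum.distrib card_binary_seqs sum_distrib_left)
  also have "(\<Sum>f\<in>binary_seqs l. \<Sum>g\<in>binary_seqs l. \<Sum>s\<in>{1..<l}. autocorr l (re_seq f) s * autocorr l (re_seq g) s) =
     (\<Sum>f\<in>binary_seqs l. \<Sum>s\<in>{1..<l}. autocorr l (re_seq f) s * (\<Sum>g\<in>binary_seqs l. autocorr l (re_seq g) s))"
    unfolding sum_distrib_left by (intro sum.cong refl, rule sum.swap)
  also have "\<dots> = 0"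
    by (intro sum.neutral ballI) (simp add: sum_autocorr_binary_seqs)
  finally have "(\<Sum>p\<in>Pair_set l. case p of (f, g) \<Rightarrow> CDF f g) = 2 ^ l * 2 ^ l"
      by simp
  then show ?thesis
    unfolding Pair_expectation_eq by (simp add: power_mult_distrib[symmetric])
qed

lemma Pair_central_moment_4_CDF:
  assumes "l > 0"
  shows "Pair_central_moment l 4 (\<lambda>(f, g). CDF f g) = 16 / real l ^ 8 *
    (\<Sum>a\<in>{1..<l}. \<Sum>b\<in>{1..<l}. \<Sum>c\<in>{1..<l}. \<Sum>d\<in>{1..<l}. (real (balanced_count l a b c d))\<^sup>2)"
proof -
  let ?S = "binary_seqs l" and ?J = "{1..<l}"
  define Q where "Q f a b c d = autocorr l (re_seq f) a * autocorr l (re_seq f) b *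
     (autocorr l (re_seq f) c * autocorr l (re_seq f) d)" for f a b c d
  define M where "M
      = (\<Sum>a\<in>?J. \<Sum>b\<in>?J. \<Sum>c\<in>?J. \<Sum>d\<in>?J. (real (balanced_count l a b c d))\<^sup>2)"
  have pow: "(CDF f g - 1) ^ 4 = 16 / real l ^ 8 *
      (\<Sum>a\<in>?J. \<Sum>b\<in>?J. \<Sum>c\<in>?J. \<Sum>d\<in>?J. Q f a b c d * Q g a b c d)"
    if "f \<in> ?S" "g \<in> ?S" for f g
  proof -
    have "(CDF f g - 1) ^ 4 = (2 / real l ^ 2) ^ 4 *
        (\<Sum>s\<in>?J. autocorr l (re_seq f) s * autocorr l (re_seq g) s) ^ 4"
      unfolding CDF_eq[OF that assms] by (simp add: power_mult_distrib power_divide)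
    also have "(2 / real l ^ 2) ^ 4 = 16 / real l ^ 8"
      by (simp add: power_divide power_mult[symmetric])
    also have "(\<Sum>s\<in>?J. autocorr l (re_seq f) s * autocorr l (re_seq g) s) ^ 4 =
        (\<Sum>a\<in>?J. \<Sum>b\<in>?J. \<Sum>c\<in>?J. \<Sum>d\<in>?J. Q f a b c d * Q g a b c d)"
      unfolding sum_power4 Q_def by (intro sum.cong refl) (simp only: mult_ac)
    finally show ?thesis .
  qed
  have "(\<Sum>p\<in>Pair_set l. ((case p of (f, g) \<Rightarrow> CDF f g) - 1) ^ 4)
      = (\<Sum>f\<in>?S. \<Sum>g\<in>?S. (CDF f g - 1) ^ 4)"
    unfolding Pair_set_def sum.cartesian_product by (simp add: case_prod_beta)
  also have "\<dots> = (\<Sum>f\<in>?S. \<Sum>g\<in>?S. 16 / real l ^ 8 *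
      (\<Sum>a\<in>?J. \<Sum>b\<in>?J. \<Sum>c\<in>?J. \<Sum>d\<in>?J. Q f a b c d * Q g a b c d))"
    by (intro sum.cong refl pow)
  also have "\<dots> = 16 / real l ^ 8 *
      (\<Sum>f\<in>?S. \<Sum>g\<in>?S. \<Sum>a\<in>?J. \<Sum>b\<in>?J. \<Sum>c\<in>?J. \<Sum>d\<in>?J. Q f a b c d * Q g a b c d)"
    by (simp only: sum_distrib_left)
  \<comment> \<open>The sums over pairs and over lengths are packed into one sum each, so that a
    single exchange suffices.\<close>
  also have "(\<Sum>f\<in>?S. \<Sum>g\<in>?S. \<Sum>a\<in>?J. \<Sum>b\<in>?J. \<Sum>c\<in>?J. \<Sum>d\<in>?J. Q f a b c d * Q g a b c d) =
     (\<Sum>p\<in>?S \<times> ?S. \<Sum>q\<in>?J \<times> ?J \<times> ?J \<times> ?J. case (p, q) of ((f, g), (a, b, c, d))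
         \<Rightarrow> Q f a b c d * Q g a b c d)"
    unfolding sum.cartesian_product' prod.case by (rule refl)
  also have "\<dots>
      = (\<Sum>q\<in>?J \<times> ?J \<times> ?J \<times> ?J. \<Sum>p\<in>?S \<times> ?S. case (p, q) of ((f, g), (a, b, c, d))
      \<Rightarrow> Q f a b c d * Q g a b c d)"
    by (rule sum.swap)
  also have "\<dots>
      = (\<Sum>a\<in>?J. \<Sum>b\<in>?J. \<Sum>c\<in>?J. \<Sum>d\<in>?J. \<Sum>f\<in>?S. \<Sum>g\<in>?S. Q f a b c d * Q g a b c d)"
    unfolding sum.cartesian_product' prod.case by (rule refl)
  also have "\<dots>
      = (\<Sum>a\<in>?J. \<Sum>b\<in>?J. \<Sum>c\<in>?J. \<Sum>d\<in>?J. 4 ^ l * (real (balanced_count l a b c d))\<^sup>2)"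
  proof (intro sum.cong refl)
    fix a b c d assume "a \<in> ?J" "b \<in> ?J" "c \<in> ?J" "d \<in> ?J"
    then have "(\<Sum>f\<in>?S. Q f a b c d) = 2 ^ l * real (balanced_count l a b c d)"
      unfolding Q_def by (intro sum_autocorr4_binary_seqs) auto
    \<comment> \<open>For fixed lengths the summand is a product of the same function of
      \<open>f\<close> and of \<open>g\<close>, so the double sum is a square.\<close>
    moreover have "(\<Sum>f\<in>?S. \<Sum>g\<in>?S. Q f a b c d * Q g a b c d)
        = (\<Sum>f\<in>?S. Q f a b c d) * (\<Sum>f\<in>?S. Q f a b c d)"
      by (rule sum_product[symmetric])
    ultimately show "(\<Sum>f\<in>?S. \<Sum>g\<in>?S. Q f a b c d * Q g a b c d)
        = 4 ^ l * (real (balanced_count l a b c d))\<^sup>2"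
      by (simp add: power2_eq_square power_mult_distrib[of 2 2 l, symmetric])
  qed
  also have "\<dots> = 4 ^ l * M"
    unfolding M_def by (simp only: sum_distrib_left)
  finally show ?thesis
    unfolding Pair_central_moment_def Pair_expectation_CDF[OF assms] unfolding Pair_expectation_eq M_def[symmetric]
    by simp
qed

section \<open>Sorting the quadruples of lengths\<close>

definition sum4 :: "'a set \<Rightarrow> ('a \<Rightarrow> 'a \<Rightarrow> 'a \<Rightarrow> 'a
    \<Rightarrow> real) \<Rightarrow> real" where
  "sum4 A h = (\<Sum>a\<in>A. \<Sum>b\<in>A. \<Sum>c\<in>A. \<Sum>d\<in>A. h a b c d)"

lemma sum4_swap:
  "sum4 A (\<lambda>a b c d. h b a c d) = sum4 A h"
  "sum4 A (\<lambda>a b c d. h a c b d) = sum4 A h"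
  "sum4 A (\<lambda>a b c d. h a b d c) = sum4 A h"
  unfolding sum4_def
  by (rule sum.swap, rule sum.cong[OF refl], rule sum.swap, rule sum.cong[OF refl],
      rule sum.cong[OF refl], rule sum.swap)

lemma sum4_perm:
  "sum4 A (\<lambda>a b c d. h c d a b) = sum4 A h"
  "sum4 A (\<lambda>a b c d. h d c a b) = sum4 A h"
  "sum4 A (\<lambda>a b c d. h a d b c) = sum4 A h"
  "sum4 A (\<lambda>a b c d. h a c d b) = sum4 A h"
  "sum4 A (\<lambda>a b c d. h b c d a) = sum4 A h"
proof -
  show adbc: "sum4 A (\<lambda>a b c d. h a d b c) = sum4 A h" for h
    using sum4_swap(2)[of A h] sum4_swap(3)[of A "\<lambda>a b c d. h a c b d"] by simp
  show acdb: "sum4 A (\<lambda>a b c d. h a c d b) = sum4 A h" for h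
    using sum4_swap(3)[of A h] sum4_swap(2)[of A "\<lambda>a b c d. h a b d c"] by simp
  show "sum4 A (\<lambda>a b c d. h b c d a) = sum4 A h"
    using acdb[of h] sum4_swap(1)[of A "\<lambda>a b c d. h a c d b"] by simp
  show cdab: "sum4 A (\<lambda>a b c d. h c d a b) = sum4 A h" for h
    using sum4_swap(2)[of A h] sum4_swap(1)[of A "\<lambda>a b c d. h a c b d"]
       sum4_swap(3)[of A "\<lambda>a b c d. h b c a d"] sum4_swap(2)[of A "\<lambda>a b c d. h b d a c"]
           by simp
  show "sum4 A (\<lambda>a b c d. h d c a b) = sum4 A h"
    using cdab[of h] sum4_swap(3)[of A "\<lambda>a b c d. h c d a b"] cdab[of "\<lambda>a b c d. h b a c d"]
      sum4_swap(1)[of A h] by simp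
qed

lemma sum4_add: "sum4 A (\<lambda>a b c d. g a b c d + h a b c d) = sum4 A g + sum4 A h"
  unfolding sum4_def by (simp add: sum.distrib)

lemma sum4_cong:
  assumes "\<And>a b c d. a \<in> A \<Longrightarrow> b \<in> A \<Longrightarrow> c \<in> A
      \<Longrightarrow> d \<in> A \<Longrightarrow> g a b c d = h a b c d"
  shows "sum4 A g = sum4 A h"
  unfolding sum4_def using assms by (intro sum.cong refl)

definition same_term :: "nat \<Rightarrow> nat \<Rightarrow> nat \<Rightarrow> nat \<Rightarrow> nat
    \<Rightarrow> real" where
  "same_term n a b c d = (if a = b \<and> b = c \<and> c = d then (3 * real (n - a) ^ 2
      - 2 * real (n - a))\<^sup>2 else 0)"

text \<open>The case of four equal lengths is left to \<open>same_term\<close>.\<close>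

definition two_term :: "nat \<Rightarrow> nat \<Rightarrow> nat \<Rightarrow> nat \<Rightarrow> nat
    \<Rightarrow> real" where
  "two_term n a b c d = (if a = b \<and> c = d \<and> a \<noteq> c
     then (real (n - a) * real (n - c) + 4 * real (n - (a + c)))\<^sup>2 else 0)"

text \<open>The factor 36 is the square of the number of orders of three edges.\<close>

definition sum_term :: "nat \<Rightarrow> nat \<Rightarrow> nat \<Rightarrow> nat \<Rightarrow> nat
    \<Rightarrow> real" where
  "sum_term n a b c d = (if d = a + b + c then 36 * (real (n - d))\<^sup>2 else 0)"

text \<open>With \<open>a\<close> longest and \<open>b\<close> shortest, the equation puts
  \<open>d\<close> strictly between them as soon as \<open>c\<close> is; \<open>c = d\<close> is
  included.\<close>

definition sums_term :: "nat \<Rightarrow> nat \<Rightarrow> nat \<Rightarrow> nat \<Rightarrow> nat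
    \<Rightarrow> real" where
  "sums_term n a b c d = (if a + b = c + d \<and> b < c \<and> c < a
     then (2 * real (n - a) + 4 * real (n - (a + b)))\<^sup>2 else 0)"

text \<open>One summand for each choice of the longest length when \<open>a\<close>,
  \<open>b\<close> are balanced against \<open>c\<close>, \<open>d\<close>; its partner is the
  shortest.\<close>

definition sums_terms :: "nat \<Rightarrow> nat \<Rightarrow> nat \<Rightarrow> nat
    \<Rightarrow> nat \<Rightarrow> real" where
  "sums_terms n a b c d =
     sums_term n a b c d + sums_term n b a c d + sums_term n c d a b + sums_term n d c a b"

lemma balanced_count_swap34: "balanced_count n a b c d = balanced_count n a b d c"
  using balanced_count_swap(1,2) by metis

text \<open>
  The eleven groups of terms have pairwise disjoint supports, so at most one summand is nonzero.
  The truncated subtractions stand for positive parts.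
\<close>

lemma square_balanced_count:
  assumes "a > 0" "b > 0" "c > 0" "d > 0"
  shows "(real (balanced_count n a b c d))\<^sup>2 = same_term n a b c d +
     two_term n a b c d + two_term n a c b d + two_term n a d b c +
     sum_term n a b c d + sum_term n a b d c + sum_term n a c d b + sum_term n b c d a +
     sums_terms n a b c d + sums_terms n a c b d + sums_terms n a d b c" (is "?T = ?R")
proof -
  note defs = same_term_def two_term_def sum_term_def sums_term_def sums_terms_def
  note sw = balanced_count_swap(1)[of n] balanced_count_swap(2)[of n] balanced_count_swap(3)[of n]
     balanced_count_swap34[of n]
  have SUM: "real (balanced_count n p q r s) ^ 2 = 36 * (real (n - s))\<^sup>2"
    if "p > 0" "q > 0" "r > 0" "s = p + q + r" for p q r s
    unfolding that(4) by (simp add: balanced_count_sum[OF that(1-3)] power_mult_distrib)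
  have SUMS: "real (balanced_count n p q r s) ^ 2 = (2 * real (n - p) + 4 * real (n - (p
      + q)))\<^sup>2"
    if "q > 0" "p + q = r + s" "q < r" "r < p" for p q r s
    using that by (subst balanced_count_sums) auto
  have TWO: "real (balanced_count n p p q q) ^ 2 = (real (n - p) * real (n - q) + 4 * real (n - (p
      + q)))\<^sup>2"
    if "p > 0" "q > 0" "p \<noteq> q" for p q
    by (simp add: balanced_count_two[OF that])
  \<comment> \<open>Two pairs with equal sums either coincide or are strictly nested. The four
    strict alternatives name the longest length and match the four summands of
    \<open>sums_terms\<close>.\<close>
  have split: "p = r \<and> q = s \<or> p = s \<and> q = r \<or> q < r \<and> r < p \<or> p < r
      \<and> r < q \<or>
      s < p \<and> p < r \<or> r < p \<and> p < s" if "p + q = r + s" for p q r s :: nat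
    using that by linarith
  have same: ?thesis if "a = b" "b = c" "c = d"
  proof -
    have "?T = (3 * real (n - a) ^ 2 - 2 * real (n - a))\<^sup>2"
      using balanced_count_same[OF assms(1)] that by simp
    then show ?thesis unfolding defs using that assms by simp
  qed
  have two1: ?thesis if "a = b" "c = d" "a \<noteq> c"
    unfolding defs using that TWO[of a c] assms by simp
  have two2: ?thesis if "a = c" "b = d" "a \<noteq> b"
  proof -
    have "balanced_count n a b a b = balanced_count n a a b b" by (rule sw(3))
    then show ?thesis unfolding defs using that TWO[of a b] assms by simp
  qed
  have two3: ?thesis if "a = d" "b = c" "a \<noteq> b"
  proof -
    have "balanced_count n a b b a = balanced_count n a a b b" using sw by metis
    then show ?thesis unfolding defs using that TWO[of a b] assms by simp
  qed
  have sum1: ?thesis if "d = a + b + c"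
    unfolding defs using that SUM[of a b c d] assms by simp
  have sum2: ?thesis if "c = a + b + d"
  proof -
    have "balanced_count n a b c d = balanced_count n a b d c" using sw by metis
    then show ?thesis unfolding defs using that SUM[of a b d c] assms by simp
  qed
  have sum3: ?thesis if "b = a + c + d"
  proof -
    have "balanced_count n a b c d = balanced_count n a c d b" using sw by metis
    then show ?thesis unfolding defs using that SUM[of a c d b] assms by simp
  qed
  have sum4: ?thesis if "a = b + c + d"
  proof -
    have "balanced_count n a b c d = balanced_count n b c d a" using sw by metis
    then show ?thesis unfolding defs using that SUM[of b c d a] assms by simp
  qed
  have s1: ?thesis if "a + b = c + d" "b < c" "c < a"
  proof -
    have "balanced_count n a b c d = balanced_count n a b c d" using sw by metis
    then show ?thesis unfolding defs using that SUMS[of b a c d] assms by simp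
  qed
  have s2: ?thesis if "a + b = c + d" "a < c" "c < b"
  proof -
    have "balanced_count n a b c d = balanced_count n b a c d" using sw by metis
    then show ?thesis unfolding defs using that SUMS[of a b c d] assms by simp
  qed
  have s3: ?thesis if "a + b = c + d" "d < a" "a < c"
  proof -
    have "balanced_count n a b c d = balanced_count n c d a b" using sw by metis
    then show ?thesis unfolding defs using that SUMS[of d c a b] assms by simp
  qed
  have s4: ?thesis if "a + b = c + d" "c < a" "a < d"
  proof -
    have "balanced_count n a b c d = balanced_count n d c a b" using sw by metis
    then show ?thesis unfolding defs using that SUMS[of c d a b] assms by simp
  qed
  have s5: ?thesis if "a + c = b + d" "c < b" "b < a"
  proof -
    have "balanced_count n a b c d = balanced_count n a c b d" using sw by metis
    then show ?thesis unfolding defs using that SUMS[of c a b d] assms by simp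
  qed
  have s6: ?thesis if "a + c = b + d" "a < b" "b < c"
  proof -
    have "balanced_count n a b c d = balanced_count n c a b d" using sw by metis
    then show ?thesis unfolding defs using that SUMS[of a c b d] assms by simp
  qed
  have s7: ?thesis if "a + c = b + d" "d < a" "a < b"
  proof -
    have "balanced_count n a b c d = balanced_count n b d a c" using sw by metis
    then show ?thesis unfolding defs using that SUMS[of d b a c] assms by simp
  qed
  have s8: ?thesis if "a + c = b + d" "b < a" "a < d"
  proof -
    have "balanced_count n a b c d = balanced_count n d b a c" using sw by metis
    then show ?thesis unfolding defs using that SUMS[of b d a c] assms by simp
  qed
  have s9: ?thesis if "a + d = b + c" "d < b" "b < a"
  proof -
    have "balanced_count n a b c d = balanced_count n a d b c" using sw by metis
    then show ?thesis unfolding defs using that SUMS[of d a b c] assms by simp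
  qed
  have s10: ?thesis if "a + d = b + c" "a < b" "b < d"
  proof -
    have "balanced_count n a b c d = balanced_count n d a b c" using sw by metis
    then show ?thesis unfolding defs using that SUMS[of a d b c] assms by simp
  qed
  have s11: ?thesis if "a + d = b + c" "c < a" "a < b"
  proof -
    have "balanced_count n a b c d = balanced_count n b c a d" using sw by metis
    then show ?thesis unfolding defs using that SUMS[of c b a d] assms by simp
  qed
  have s12: ?thesis if "a + d = b + c" "b < a" "a < c"
  proof -
    have "balanced_count n a b c d = balanced_count n c b a d" using sw by metis
    then show ?thesis unfolding defs using that SUMS[of b c a d] assms by simp
  qed
  have none: ?thesis if "\<not> (a = b + c + d \<or> b = a + c + d \<or> c = a + b + d \<or> d = a
      + b + c \<or>
    a + b = c + d \<or> a + c = b + d \<or> a + d = b + c)"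
  proof -
    have "same_term n a b c d = 0" "two_term n a b c d = 0" "two_term n a c b d
        = 0" "two_term n a d b c = 0"
      unfolding same_term_def two_term_def using that by auto
    moreover have "sum_term n a b c d = 0" "sum_term n a b d c = 0" "sum_term n a c d b
        = 0" "sum_term n b c d a = 0"
      unfolding sum_term_def using that by auto
    moreover have "sums_terms n p q r s = 0" if "p + q \<noteq> r + s" for p q r s
      unfolding sums_terms_def sums_term_def using that by (simp add: add.commute eq_commute)
    ultimately show ?thesis using that balanced_count_eq_0[OF assms that, of n] by simp
  qed
  have two1': ?thesis if "a = b" "c = d"
    by (cases "a = c") (rule same two1; use that in simp)+
  have two2': ?thesis if "a = c" "b = d"
    by (cases "a = b") (rule same two2; use that in simp)+
  have two3': ?thesis if "a = d" "b = c"
    by (cases "a = b") (rule same two3; use that in simp)+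
  show ?thesis
  proof (cases "a + b = c + d \<or> a + c = b + d \<or> a + d = b + c")
    case True
    then consider (e1) "a + b = c + d" | (e2) "a + c = b + d" | (e3) "a + d = b + c" by (elim disjE)
    then show ?thesis
    proof cases
      case e1
      from split[OF e1] show ?thesis
        by (elim disjE conjE) (rule two2' two3' s1[OF e1] s2[OF e1] s3[OF e1] s4[OF e1]; assumption)+
    next
      case e2
      from split[OF e2] show ?thesis
        by (elim disjE conjE) (rule two1' two3' s5[OF e2] s6[OF e2] s7[OF e2] s8[OF e2]; (assumption | erule sym))+
    next
      case e3
      from split[OF e3] show ?thesis
        by (elim disjE conjE) (rule two1' two2' s9[OF e3] s10[OF e3] s11[OF e3] s12[OF e3]; (assumption | erule sym))+
    qed
  next
    case False
    show ?thesis
    proof (cases "a = b + c + d \<or> b = a + c + d \<or> c = a + b + d \<or> d = a + b + c")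
      case True
      then show ?thesis by (elim disjE) (erule sum4 sum3 sum2 sum1)+
    next
      case F: False
      with False show ?thesis by (intro none) blast
    qed
  qed
qed

section \<open>Collapsing the fourfold sums\<close>

lemma sum4_same_term:
  assumes "finite A"
  shows "sum4 A (same_term n) = (\<Sum>a\<in>A. (3 * real (n - a) ^ 2 - 2 * real (n - a))\<^sup>2)"
proof -
  have "sum4 A (same_term n) = (\<Sum>a\<in>A. \<Sum>b\<in>A. \<Sum>c\<in>A. \<Sum>d\<in>A.
     if d = c then if c = b then if b = a then (3 * real (n - a) ^ 2 - 2 * real (n
         - a))\<^sup>2 else 0 else 0 else 0)"
    unfolding sum4_def same_term_def by (intro sum.cong refl) auto
  also have "\<dots> = (\<Sum>a\<in>A. (3 * real (n - a) ^ 2 - 2 * real (n - a))\<^sup>2)"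
    using assms by (simp add: sum.delta)
  finally show ?thesis .
qed

lemma sum4_two_term:
  assumes "finite A"
  shows "sum4 A (two_term n) = (\<Sum>a\<in>A. \<Sum>c\<in>A.
    if a = c then 0 else (real (n - a) * real (n - c) + 4 * real (n - (a + c)))\<^sup>2)"
proof -
  have "sum4 A (two_term n) = (\<Sum>a\<in>A. \<Sum>b\<in>A. \<Sum>c\<in>A. \<Sum>d\<in>A.
     if d = c then if b = a then if a = c then 0 else (real (n - a) * real (n - c) + 4 * real (n
         - (a + c)))\<^sup>2 else 0 else 0)"
    unfolding sum4_def two_term_def by (intro sum.cong refl) auto
  also have "\<dots> = (\<Sum>a\<in>A. \<Sum>b\<in>A. if b = a then \<Sum>c\<in>A.
     if a = c then 0 else (real (n - a) * real (n - c) + 4 * real (n - (a + c)))\<^sup>2 else 0)"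
    using assms by (intro sum.cong refl) (auto simp add: sum.delta)
  also have "\<dots> = (\<Sum>a\<in>A. \<Sum>c\<in>A.
     if a = c then 0 else (real (n - a) * real (n - c) + 4 * real (n - (a + c)))\<^sup>2)"
    using assms by (simp add: sum.delta)
  finally show ?thesis .
qed

text \<open>The three shorter lengths determine \<open>d\<close>. If \<open>d\<close> falls outside
  the range, truncated subtraction makes the right-hand term 0 as well.\<close>

lemma sum4_sum_term:
  "sum4 {1..<n} (sum_term n) =
    36 * (\<Sum>a\<in>{1..<n}. \<Sum>b\<in>{1..<n}. \<Sum>c\<in>{1..<n}. (real (n - (a + b
        + c)))\<^sup>2)"
proof -
  have "(\<Sum>d\<in>{1..<n}. sum_term n a b c d) = 36 * (real (n - (a + b
      + c)))\<^sup>2" if "a > 0" for a b c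
    using that unfolding sum_term_def by (auto simp: sum.delta)
  then show ?thesis unfolding sum4_def by (simp add: sum_distrib_left)
qed

text \<open>For longest \<open>a\<close> and shortest \<open>b\<close> there are
  \<open>a - b - 1\<close> values of \<open>c\<close> strictly between them, and \<open>d\<close>
  follows. For \<open>a\<close> at most \<open>b\<close> the truncated weight is 0.\<close>

lemma sum4_sums_term:
  "sum4 {1..<n} (sums_term n) = (\<Sum>a\<in>{1..<n}. \<Sum>b\<in>{1..<n}.
     real (a - b - 1) * (2 * real (n - a) + 4 * real (n - (a + b)))\<^sup>2)"
  unfolding sum4_def
proof (intro sum.cong refl)
  fix a b assume a: "a \<in> {1..<n}" and b: "b \<in> {1..<n}"
  let ?v = "(2 * real (n - a) + 4 * real (n - (a + b)))\<^sup>2"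
  have "(\<Sum>d\<in>{1..<n}. sums_term n a b c d) = (if b < c \<and> c < a then ?v else 0)" for c
  proof (cases "b < c \<and> c < a")
    case True
    have "(\<Sum>d\<in>{1..<n}. sums_term n a b c d) = (\<Sum>d\<in>{1..<n}. if d = a + b
        - c then ?v else 0)"
      unfolding sums_term_def by (intro sum.cong refl) (use True in auto)
    then show ?thesis using True a b by (auto simp: sum.delta)
  next
    case False
    then have "sums_term n a b c d = 0" for d unfolding sums_term_def by auto
    then show ?thesis using False by auto
  qed
  then have "(\<Sum>c\<in>{1..<n}. \<Sum>d\<in>{1..<n}. sums_term n a b c d)
      = (\<Sum>c\<in>{1..<n}. if b < c \<and> c < a then ?v else 0)"
    by simp
  also have "\<dots> = (\<Sum>c\<in>{b<..<a}. ?v)"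
    by (rule sum.mono_neutral_cong_right) (use a in auto)
  also have "\<dots> = real (a - b - 1) * ?v" by simp
  finally show "(\<Sum>c\<in>{1..<n}. \<Sum>d\<in>{1..<n}. sums_term n a b c d) = real (a - b
      - 1) * ?v" .
qed

text \<open>The factor 3 counts pairings, 144 is four choices of the longest length times 36, and 12
  is three pairings times four choices of the longest length.\<close>

lemma sum_square_balanced_count:
  "(\<Sum>a\<in>{1..<n}. \<Sum>b\<in>{1..<n}. \<Sum>c\<in>{1..<n}. \<Sum>d\<in>{1..<n}. (real (balanced_count n a b c d))\<^sup>2) =
   (\<Sum>a\<in>{1..<n}. (3 * real (n - a) ^ 2 - 2 * real (n - a))\<^sup>2) +
   3 * (\<Sum>a\<in>{1..<n}. \<Sum>c\<in>{1..<n}.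
      if a = c then 0 else (real (n - a) * real (n - c) + 4 * real (n - (a + c)))\<^sup>2) +
   144 * (\<Sum>a\<in>{1..<n}. \<Sum>b\<in>{1..<n}. \<Sum>c\<in>{1..<n}. (real (n - (a + b
       + c)))\<^sup>2) +
   12 * (\<Sum>a\<in>{1..<n}. \<Sum>b\<in>{1..<n}. real (a - b - 1) * (2 * real (n - a)
       + 4 * real (n - (a + b)))\<^sup>2)"
proof -
  let ?J = "{1..<n}"
  have sums: "sum4 ?J (sums_terms n) = 4 * sum4 ?J (sums_term n)"
    unfolding sums_terms_def sum4_add
    using sum4_swap(1)[of ?J "sums_term n"] sum4_perm(1)[of ?J "sums_term n"]
      sum4_perm(2)[of ?J "sums_term n"] by simp
  have "sum4 ?J (\<lambda>a b c d. (real (balanced_count n a b c d))\<^sup>2)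
      = sum4 ?J (\<lambda>a b c d. same_term n a b c d +
     two_term n a b c d + two_term n a c b d + two_term n a d b c +
     sum_term n a b c d + sum_term n a b d c + sum_term n a c d b + sum_term n b c d a +
     sums_terms n a b c d + sums_terms n a c b d + sums_terms n a d b c)"
    by (intro sum4_cong square_balanced_count) auto
  also have "\<dots> = sum4 ?J (same_term n) + 3 * sum4 ?J (two_term n) + 4 * sum4 ?J (sum_term n) +
      3 * sum4 ?J (sums_terms n)"
    unfolding sum4_add
    using sum4_swap(2)[of ?J "two_term n"] sum4_perm(3)[of ?J "two_term n"]
      sum4_swap(2)[of ?J "sums_terms n"] sum4_perm(3)[of ?J "sums_terms n"]
      sum4_swap(3)[of ?J "sum_term n"] sum4_perm(4)[of ?J "sum_term n"] sum4_perm(5)[of ?J "sum_term n"]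
    by simp
  finally show ?thesis
    unfolding sums sum4_same_term[OF finite_atLeastLessThan] sum4_two_term[OF finite_atLeastLessThan]
      sum4_sum_term sum4_sums_term unfolding sum4_def by simp
qed

section \<open>Closed forms\<close>

text \<open>Telescoping: \<open>P\<close> is a discrete antiderivative of \<open>f\<close>. With
  real arguments the difference equation becomes a polynomial identity without truncated
  subtraction.\<close>

lemma sum_lessThan_closed_form:
  fixes f P :: "real \<Rightarrow> real"
  assumes "P 0 = 0" "\<And>x. P (x + 1) - P x = f x"
  shows "(\<Sum>i<m. f (real i)) = P (real m)"
proof (induction m)
  case (Suc m)
  then show ?case using assms(2)[of "real m"] by (simp add: add.commute)
qed (simp add: assms(1))

text \<open>The condition \<open>F 0 = 0\<close> absorbs all indices beyond \<open>m\<close>, where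
  the subtraction is truncated, and it supplies the term \<open>k = 0\<close> after
  reversal.\<close>

lemma sum_shift_diff:
  fixes F :: "nat \<Rightarrow> real"
  assumes "F 0 = 0" "m \<le> n"
  shows "(\<Sum>c\<in>{1..<n}. F (m - c)) = (\<Sum>k<m. F k)"
proof -
  have "(\<Sum>c\<in>{1..<n}. F (m - c)) = (\<Sum>c\<in>{1..<m}. F (m - c))"
    by (rule sum.mono_neutral_right) (use assms in auto)
  also have "\<dots> = (\<Sum>k\<in>{1..<m}. F k)"
    by (rule sum.reindex_bij_witness[of _ "\<lambda>k. m - k" "\<lambda>k. m - k"]) auto
  also have "\<dots> = (\<Sum>k<m. F k)"
    by (rule sum.mono_neutral_left) (use assms in \<open>auto simp: not_less_eq_eq\<close>)
  finally show ?thesis .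
qed

text \<open>The reversal is exact here, so \<open>F\<close> may be nonzero at 0, as happens on the
  diagonal for odd \<open>n\<close>.\<close>

lemma sum_shift_diff_atMost:
  fixes F :: "nat \<Rightarrow> real"
  shows "(\<Sum>a\<in>{1..k}. F (k - a)) = (\<Sum>i<k. F i)"
  by (rule sum.reindex_bij_witness[of _ "\<lambda>i. k - i" "\<lambda>a. k - a"]) auto

lemma sum_squares_lessThan: "(\<Sum>k<m. (real k)\<^sup>2) = (2 * real m ^ 3 - 3 * real m ^ 2
    + real m) / 6"
  by (rule sum_lessThan_closed_form[where P = "\<lambda>x. (2 * x ^ 3 - 3 * x ^ 2 + x) / 6"])
     (simp, simp add: field_simps, algebra)

lemma sum_same_closed:
  "(\<Sum>a\<in>{1..<n}. (3 * real (n - a) ^ 2 - 2 * real (n - a))\<^sup>2) = (54 * real n ^ 5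
      - 225 * real n ^ 4 + 310 * real n ^ 3 - 150 * real n ^ 2 + 11 * real n) / 30"
proof -
  have "(\<Sum>a\<in>{1..<n}. (3 * real (n - a) ^ 2 - 2 * real (n - a))\<^sup>2)
      = (\<Sum>k<n. (3 * real k ^ 2 - 2 * real k)\<^sup>2)"
    by (rule sum_shift_diff[where F = "\<lambda>k. (3 * real k ^ 2 - 2 * real k)\<^sup>2"]) simp_all
  also have "\<dots> = (54 * real n ^ 5 - 225 * real n ^ 4 + 310 * real n ^ 3 - 150 * real n ^ 2
      + 11 * real n) / 30"
    by (rule sum_lessThan_closed_form[where P = "\<lambda>x. (54 * x ^ 5 - 225 * x ^ 4 + 310 * x ^ 3
        - 150 * x ^ 2 + 11 * x) / 30"])
       (simp, simp add: field_simps, algebra)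
  finally show ?thesis .
qed

text \<open>Each summation yields a polynomial in the remaining length that vanishes at 0, as the
  next one requires. The result is n(n-1)(n-2)(n-3)(2n-3)/120.\<close>

lemma sum_three_closed:
  "(\<Sum>a\<in>{1..<n}. \<Sum>b\<in>{1..<n}. \<Sum>c\<in>{1..<n}. (real (n - (a + b + c)))\<^sup>2)
      = (2 * real n ^ 5 - 15 * real n ^ 4 + 40 * real n ^ 3 - 45 * real n ^ 2 + 18 * real n) / 120"
proof -
  have 1: "(\<Sum>c\<in>{1..<n}. (real (n - (a + b + c)))\<^sup>2) =
      (2 * real (n - a - b) ^ 3 - 3 * real (n - a - b) ^ 2 + real (n - a - b)) / 6" for a b
    using sum_shift_diff[where F = "\<lambda>k. (real k)\<^sup>2" and m = "n - a - b" and n = n]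
    by (simp add: sum_squares_lessThan)
  have 2: "(\<Sum>b\<in>{1..<n}. \<Sum>c\<in>{1..<n}. (real (n - (a + b + c)))\<^sup>2) =
      (real (n - a) ^ 4 - 4 * real (n - a) ^ 3 + 5 * real (n - a) ^ 2 - 2 * real (n
          - a)) / 12" for a
  proof -
    have "(\<Sum>b\<in>{1..<n}. \<Sum>c\<in>{1..<n}. (real (n - (a + b + c)))\<^sup>2) =
        (\<Sum>k<n - a. (2 * real k ^ 3 - 3 * real k ^ 2 + real k) / 6)"
      unfolding 1
      by (rule sum_shift_diff[where F = "\<lambda>k. (2 * real k ^ 3 - 3 * real k ^ 2
          + real k) / 6"]) simp_all
    also have "\<dots> = (real (n - a) ^ 4 - 4 * real (n - a) ^ 3 + 5 * real (n - a) ^ 2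
        - 2 * real (n - a)) / 12"
      by (rule sum_lessThan_closed_form[where P = "\<lambda>x. (x ^ 4 - 4 * x ^ 3 + 5 * x ^ 2
          - 2 * x) / 12"])
         (simp, simp add: field_simps, algebra)
    finally show ?thesis .
  qed
  have "(\<Sum>a\<in>{1..<n}. \<Sum>b\<in>{1..<n}. \<Sum>c\<in>{1..<n}. (real (n - (a + b
      + c)))\<^sup>2) =
      (\<Sum>k<n. (real k ^ 4 - 4 * real k ^ 3 + 5 * real k ^ 2 - 2 * real k) / 12)"
    unfolding 2 by (rule sum_shift_diff[where F = "\<lambda>k. (real k ^ 4 - 4 * real k ^ 3
        + 5 * real k ^ 2 - 2 * real k) / 12"]) simp_all
  also have "\<dots> = (2 * real n ^ 5 - 15 * real n ^ 4 + 40 * real n ^ 3 - 45 * real n ^ 2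
      + 18 * real n) / 120"
    by (rule sum_lessThan_closed_form[where P = "\<lambda>x. (2 * x ^ 5 - 15 * x ^ 4 + 40 * x ^ 3
        - 45 * x ^ 2 + 18 * x) / 120"])
       (simp, simp add: field_simps, algebra)
  finally show ?thesis .
qed

lemma sum_two_all_closed:
  "(\<Sum>a\<in>{1..<n}. \<Sum>c\<in>{1..<n}. (real (n - a) * real (n - c) + 4 * real (n - (a
      + c)))\<^sup>2) = ((20 * real n ^ 6 + 72 * real n ^ 5 - 175 * real n ^ 4 - 450 * real n ^ 3
      + 965 * real n ^ 2 - 432 * real n) / 180)"
proof -
  \<comment> \<open>\<open>G\<close> is the inner sum as a polynomial in \<open>N = n - a\<close>
    and \<open>n\<close>, with \<open>a\<close> eliminated.\<close>
  define G where "G N = (2 * real N ^ 2 * real n ^ 3 - 8 * real N ^ 4 + 24 * real N ^ 3 * real n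
      - 3 * real N ^ 2 * real n ^ 2 + 32 * real N ^ 3 - 23 * real N ^ 2 * real n - 40 * real N ^ 2
      + 16 * real N) / 6" for N :: nat
  have inner: "(\<Sum>c\<in>{1..<n}. (real (n - a) * real (n - c) + 4 * real (n - (a + c)))\<^sup>2)
      = G (n - a)"
    if a: "a \<in> {1..<n}" for a
  proof -
    let ?N = "n - a"
    have ra: "real a = real n - real ?N" using a by (simp add: of_nat_diff)
    \<comment> \<open>\<open>F\<close> collects what the square adds to \<open>N\<close> squared
      times \<open>n - c\<close> squared. It depends on the positive part \<open>k\<close> of
      \<open>n - a - c\<close>, and \<open>n - c\<close> equals \<open>k + a\<close> when
      \<open>k\<close> is positive.\<close>
    define F where "F k = 8 * real ?N * (real k + real a) * real k
        + 16 * (real k)\<^sup>2" for k :: nat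
    have "(real ?N * real (n - c) + 4 * real (n - (a + c)))\<^sup>2 = (real ?N)\<^sup>2 * (real (n
        - c))\<^sup>2 + F (?N - c)" for c
    proof (cases "a + c < n")
      case True
      then have *: "real (n - (a + c)) = real (?N - c)" "real (n - c) = real (?N - c) + real a"
          by auto
      show ?thesis unfolding F_def * by algebra
    next
      case False
      then have "n - (a + c) = 0" "?N - c = 0" by auto
      then show ?thesis unfolding F_def by (simp add: power_mult_distrib)
    qed
    note expand = this
    have "(\<Sum>c\<in>{1..<n}. (real ?N * real (n - c) + 4 * real (n - (a + c)))\<^sup>2) =
        (real ?N)\<^sup>2 * (\<Sum>c\<in>{1..<n}. (real (n - c))\<^sup>2)
            + (\<Sum>c\<in>{1..<n}. F (?N - c))"
      by (simp only: expand sum.distrib sum_distrib_left)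
    also have "(\<Sum>c\<in>{1..<n}. (real (n - c))\<^sup>2) = (\<Sum>k<n. (real k)\<^sup>2)"
      by (rule sum_shift_diff[where F = "\<lambda>k. (real k)\<^sup>2"]) simp_all
    also have "(\<Sum>c\<in>{1..<n}. F (?N - c)) = (\<Sum>k<?N. F k)"
      by (rule sum_shift_diff) (simp_all add: F_def)
    also have "\<dots> = 8 * real ?N * ((2 * real ?N ^ 3 - 3 * real ?N ^ 2 + real ?N) / 6 +
        real a * (real ?N ^ 2 - real ?N) / 2) + 16 * ((2 * real ?N ^ 3 - 3 * real ?N ^ 2
            + real ?N) / 6)"
      unfolding F_def
      by (rule sum_lessThan_closed_form[where f = "\<lambda>x. 8 * real ?N * (x + real a) * x
          + 16 * x\<^sup>2" and
          P = "\<lambda>x. 8 * real ?N * ((2 * x ^ 3 - 3 * x ^ 2 + x) / 6 +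
        real a * (x ^ 2 - x) / 2) + 16 * ((2 * x ^ 3 - 3 * x ^ 2 + x) / 6)"])
         (simp, simp add: field_simps, algebra)
    finally show ?thesis unfolding sum_squares_lessThan G_def ra by (simp add: field_simps) algebra
  qed
  have "(\<Sum>a\<in>{1..<n}. \<Sum>c\<in>{1..<n}. (real (n - a) * real (n - c) + 4 * real (n - (a
      + c)))\<^sup>2) =
      (\<Sum>a\<in>{1..<n}. G (n - a))"
    by (intro sum.cong refl inner)
  also have "\<dots> = (\<Sum>k<n. G k)"
    by (rule sum_shift_diff) (simp_all add: G_def)
  \<comment> \<open>Powers of \<open>real n\<close> stay unmerged because some come from the upper
    limit and others from the parameter in the summand, which telescoping keeps fixed.\<close>
  also have "\<dots> = (20 * real n ^ 3 * real n ^ 3 - 48 * real n ^ 5 + 180 * real n ^ 4 * real n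
      - 30 * real n ^ 3 * real n ^ 2 - 30 * real n ^ 2 * real n ^ 3 + 360 * real n ^ 4
      - 590 * real n ^ 3 * real n + 45 * real n ^ 2 * real n ^ 2 + 10 * real n * real n ^ 3
      - 960 * real n ^ 3 + 525 * real n ^ 2 * real n - 15 * real n * real n ^ 2 + 1080 * real n ^ 2
      - 115 * real n * real n - 432 * real n) / 180"
    unfolding G_def
    by (rule sum_lessThan_closed_form[where P = "\<lambda>x. (20 * x ^ 3 * real n ^ 3 - 48 * x ^ 5
        + 180 * x ^ 4 * real n - 30 * x ^ 3 * real n ^ 2 - 30 * x ^ 2 * real n ^ 3 + 360 * x ^ 4
        - 590 * x ^ 3 * real n + 45 * x ^ 2 * real n ^ 2 + 10 * x * real n ^ 3 - 960 * x ^ 3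
        + 525 * x ^ 2 * real n - 15 * x * real n ^ 2 + 1080 * x ^ 2 - 115 * x * real n
        - 432 * x) / 180" and f = "\<lambda>x. (2 * x ^ 2 * real n ^ 3 - 8 * x ^ 4
        + 24 * x ^ 3 * real n - 3 * x ^ 2 * real n ^ 2 + 32 * x ^ 3 - 23 * x ^ 2 * real n
        - 40 * x ^ 2 + 16 * x) / 6"])
       (simp, simp add: field_simps, algebra)
  also have "\<dots> = ((20 * real n ^ 6 + 72 * real n ^ 5 - 175 * real n ^ 4 - 450 * real n ^ 3
      + 965 * real n ^ 2 - 432 * real n) / 180)" by (simp add: field_simps; algebra?)
  finally show ?thesis .
qed

lemma sum_fourth_powers: "(\<Sum>a\<in>{1..<n}. real (n - a) ^ 4) = ((6 * real n ^ 5
    - 15 * real n ^ 4 + 10 * real n ^ 3 - real n) / 30)"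
proof -
  have "(\<Sum>a\<in>{1..<n}. real (n - a) ^ 4) = (\<Sum>k<n. real k ^ 4)"
    by (rule sum_shift_diff[where F = "\<lambda>k. real k ^ 4"]) simp_all
  also have "\<dots> = ((6 * real n ^ 5 - 15 * real n ^ 4 + 10 * real n ^ 3 - real n) / 30)"
    by (rule sum_lessThan_closed_form[where P = "\<lambda>x. (6 * x ^ 5 - 15 * x ^ 4 + 10 * x ^ 3
        - x) / 30"])
       (simp, simp add: field_simps, algebra)
  finally show ?thesis .
qed

text \<open>Only \<open>a\<close> up to \<open>n / 2\<close> contributes. With x = k - a, the
  factors \<open>n - a\<close> and \<open>n - 2 * a\<close> become k + x and 2x; for odd
  \<open>n\<close> they become k + 1 + x and 2x + 1.\<close>

lemma sum_two_diag_even: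
  assumes "n = 2 * k"
  shows "(\<Sum>a\<in>{1..<n}. 8 * (real (n - a))\<^sup>2 * real (n - 2 * a) + 16 * (real (n
      - 2 * a))\<^sup>2) = (68 * real k ^ 4 - 32 * real k ^ 3 - 68 * real k ^ 2 + 32 * real k) / 3"
proof -
  let ?f = "\<lambda>x. 16 * x ^ 3 + 32 * x ^ 2 * real k + 16 * x * real k ^ 2 + 64 * x ^ 2"
  have "(\<Sum>a\<in>{1..<n}. 8 * (real (n - a))\<^sup>2 * real (n - 2 * a) + 16 * (real (n
      - 2 * a))\<^sup>2) =
      (\<Sum>a\<in>{1..k}. ?f (real (k - a)))"
  proof (rule sum.mono_neutral_cong)
    fix a assume "a \<in> {1..<n} \<inter> {1..k}"
    then have "real (n - a) = real k + real (k - a)" "real (n - 2 * a) = 2 * real (k - a)"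
      using assms by auto
    then show "8 * (real (n - a))\<^sup>2 * real (n - 2 * a) + 16 * (real (n - 2 * a))\<^sup>2
        = ?f (real (k - a))"
      by algebra
  qed (use assms in auto)
  also have "\<dots> = (\<Sum>i<k. ?f (real i))"
    by (rule sum_shift_diff_atMost[where F = "\<lambda>i. ?f (real i)"])
  also have "\<dots> = (12 * real k ^ 4 + 32 * real k ^ 3 * real k + 24 * real k ^ 2 * real k ^ 2
      + 40 * real k ^ 3 - 48 * real k ^ 2 * real k - 24 * real k * real k ^ 2 - 84 * real k ^ 2
      + 16 * real k * real k + 32 * real k) / 3"
    by (rule sum_lessThan_closed_form[where P = "\<lambda>x. (12 * x ^ 4 + 32 * x ^ 3 * real k
        + 24 * x ^ 2 * real k ^ 2 + 40 * x ^ 3 - 48 * x ^ 2 * real k - 24 * x * real k ^ 2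
        - 84 * x ^ 2 + 16 * x * real k + 32 * x) / 3"])
       (simp, simp add: field_simps, algebra)
  also have "\<dots> = (68 * real k ^ 4 - 32 * real k ^ 3 - 68 * real k ^ 2 + 32 * real k) / 3"
      by (simp add: field_simps; algebra?)
  finally show ?thesis .
qed

lemma sum_two_diag_odd:
  assumes "n = 2 * k + 1"
  shows "(\<Sum>a\<in>{1..<n}. 8 * (real (n - a))\<^sup>2 * real (n - 2 * a) + 16 * (real (n
      - 2 * a))\<^sup>2) = (68 * real k ^ 4 + 104 * real k ^ 3 - 8 * real k ^ 2 - 20 * real k) / 3"
proof -
  let ?f = "\<lambda>x. 16 * x ^ 3 + 32 * x ^ 2 * real k + 16 * x * real k ^ 2 + 104 * x ^ 2
      + 48 * x * real k + 8 * real k ^ 2 + 96 * x + 16 * real k + 24"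
  have "(\<Sum>a\<in>{1..<n}. 8 * (real (n - a))\<^sup>2 * real (n - 2 * a) + 16 * (real (n
      - 2 * a))\<^sup>2) =
      (\<Sum>a\<in>{1..k}. ?f (real (k - a)))"
  proof (rule sum.mono_neutral_cong)
    fix a assume "a \<in> {1..<n} \<inter> {1..k}"
    then have "real (n - a) = real k + 1 + real (k - a)" "real (n - 2 * a) = 2 * real (k - a) + 1"
      using assms by auto
    then show "8 * (real (n - a))\<^sup>2 * real (n - 2 * a) + 16 * (real (n - 2 * a))\<^sup>2
        = ?f (real (k - a))"
      by algebra
  qed (use assms in auto)
  also have "\<dots> = (\<Sum>i<k. ?f (real i))"
    by (rule sum_shift_diff_atMost[where F = "\<lambda>i. ?f (real i)"])
  also have "\<dots> = (12 * real k ^ 4 + 32 * real k ^ 3 * real k + 24 * real k ^ 2 * real k ^ 2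
      + 80 * real k ^ 3 + 24 * real k ^ 2 * real k - 8 * real k * real k - 20 * real k) / 3"
    by (rule sum_lessThan_closed_form[where P = "\<lambda>x. (12 * x ^ 4 + 32 * x ^ 3 * real k
        + 24 * x ^ 2 * real k ^ 2 + 80 * x ^ 3 + 24 * x ^ 2 * real k - 8 * x * real k
        - 20 * x) / 3"])
       (simp, simp add: field_simps, algebra)
  also have "\<dots> = (68 * real k ^ 4 + 104 * real k ^ 3 - 8 * real k ^ 2 - 20 * real k) / 3"
      by (simp add: field_simps; algebra?)
  finally show ?thesis .
qed

text \<open>The diagonal is subtracted from the full double sum. Its fourth powers have a uniform
  closed form, while the part with \<open>n - 2 * a\<close> stays unevaluated because it depends on
  parity.\<close>

lemma sum_two_closed:
  "(\<Sum>a\<in>{1..<n}. \<Sum>c\<in>{1..<n}.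
      if a = c then 0 else (real (n - a) * real (n - c) + 4 * real (n - (a + c)))\<^sup>2) =
   ((20 * real n ^ 6 + 72 * real n ^ 5 - 175 * real n ^ 4 - 450 * real n ^ 3 + 965 * real n ^ 2
       - 432 * real n) / 180) - ((6 * real n ^ 5 - 15 * real n ^ 4 + 10 * real n ^ 3
       - real n) / 30) -
   (\<Sum>a\<in>{1..<n}. 8 * (real (n - a))\<^sup>2 * real (n - 2 * a) + 16 * (real (n
       - 2 * a))\<^sup>2)"
proof -
  let ?h = "\<lambda>a c. (real (n - a) * real (n - c) + 4 * real (n - (a + c)))\<^sup>2"
  have "(\<Sum>c\<in>{1..<n}. if a = c then 0 else ?h a c) = (\<Sum>c\<in>{1..<n}. ?h a c) - ?h a a"
    if "a \<in> {1..<n}" for a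
  proof -
    have "(\<Sum>c\<in>{1..<n}. if a = c then 0 else ?h a c) = (\<Sum>c\<in>{1..<n}. ?h a c - (if a
        = c then ?h a c else 0))"
      by (intro sum.cong refl) auto
    then show ?thesis using that by (simp add: sum_subtractf sum.delta')
  qed
  then have "(\<Sum>a\<in>{1..<n}. \<Sum>c\<in>{1..<n}. if a = c then 0 else ?h a c) =
      (\<Sum>a\<in>{1..<n}. \<Sum>c\<in>{1..<n}. ?h a c) - (\<Sum>a\<in>{1..<n}. ?h a a)"
    by (simp add: sum_subtractf)
  also have "(\<Sum>a\<in>{1..<n}. ?h a a) = (\<Sum>a\<in>{1..<n}. real (n - a) ^ 4 +
      (8 * (real (n - a))\<^sup>2 * real (n - 2 * a) + 16 * (real (n - 2 * a))\<^sup>2))"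
    by (intro sum.cong refl) (simp add: mult_2[symmetric], algebra)
  finally show ?thesis
    unfolding sum_two_all_closed sum.distrib[of "\<lambda>a. real (n - a) ^ 4"] sum_fourth_powers
        by simp
qed

text \<open>Summing over \<open>b\<close> leaves (a-1)(a-2)/2, the number of ways to write
  \<open>a\<close> as an ordered sum of three positive integers. The value is therefore four times
  the sum in \<open>sum_three_closed\<close>.\<close>

lemma sum_sums_first:
  assumes "n > 0"
  shows "(\<Sum>a\<in>{1..<n}. \<Sum>b\<in>{1..<n}. real (a - b - 1) * (4 * (real (n - a))\<^sup>2))
      = ((2 * real n ^ 5 - 15 * real n ^ 4 + 40 * real n ^ 3 - 45 * real n ^ 2 + 18 * real n) / 30)"
proof -
  have *: "(\<Sum>b\<in>{1..<n}. real (a - b - 1)) = (real a - 1) * (real a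
      - 2) / 2" if a: "a \<in> {1..<n}" for a
  proof -
    have "(\<Sum>b\<in>{1..<n}. real (a - b - 1)) = (\<Sum>k<a. real (k - 1))"
      using sum_shift_diff[where F = "\<lambda>k. real (k - 1)" and m = a and n = n] a by simp
    also have "\<dots> = (real a - 1) * (real a - 2) / 2" using a
    proof (induction a)
      case (Suc a)
      then show ?case
        by (cases "a = 0") (simp_all add: of_nat_diff field_simps)
    qed simp
    finally show ?thesis .
  qed
  have "(\<Sum>a\<in>{1..<n}. \<Sum>b\<in>{1..<n}. real (a - b - 1) * (4 * (real (n
      - a))\<^sup>2)) =
      (\<Sum>a\<in>{1..<n}. (real a - 1) * (real a - 2) / 2 * (4 * (real (n - a))\<^sup>2))"
    unfolding sum_distrib_right[symmetric] by (intro sum.cong refl) (simp only: *)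
  also have "\<dots> = (\<Sum>i<n - 1. 2 * real i ^ 4 - 4 * real i ^ 3 * real n
      + 2 * real i ^ 2 * real n ^ 2 + 2 * real i ^ 3 - 2 * real i * real n ^ 2 - 2 * real i ^ 2
      + 4 * real i * real n - 2 * real i)"
  proof (rule sum.reindex_bij_witness[of _ "\<lambda>i. i + 1" "\<lambda>a. a - 1"])
    fix a assume a: "a \<in> {1..<n}"
    then have **: "real a = real (a - 1) + 1" "real (n - a) = real n - real (a - 1) - 1" by auto
    have "(real (a - 1) + 1 - 1) * (real (a - 1) + 1 - 2) / 2 * (4 * (real n - real (a - 1)
        - 1)\<^sup>2) =
        (\<lambda>i. 2 * real i ^ 4 - 4 * real i ^ 3 * real n + 2 * real i ^ 2 * real n ^ 2
            + 2 * real i ^ 3 - 2 * real i * real n ^ 2 - 2 * real i ^ 2 + 4 * real i * real n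
            - 2 * real i) (a - 1)"
      by (simp add: field_simps) algebra
    then show "(\<lambda>i. 2 * real i ^ 4 - 4 * real i ^ 3 * real n + 2 * real i ^ 2 * real n ^ 2
        + 2 * real i ^ 3 - 2 * real i * real n ^ 2 - 2 * real i ^ 2 + 4 * real i * real n
        - 2 * real i) (a - 1) = (real a - 1) * (real a - 2) / 2 * (4 * (real (n - a))\<^sup>2)"
      by (simp only: **[symmetric])
  qed auto
  also have "\<dots> = (12 * real (n - 1) ^ 5 - 30 * real (n - 1) ^ 4 * real n + 20 * real (n
      - 1) ^ 3 * real n ^ 2 - 15 * real (n - 1) ^ 4 + 60 * real (n - 1) ^ 3 * real n - 60 * real (n
      - 1) ^ 2 * real n ^ 2 - 30 * real (n - 1) ^ 3 + 30 * real (n - 1) ^ 2 * real n + 40 * real (n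
      - 1) * real n ^ 2 + 15 * real (n - 1) ^ 2 - 60 * real (n - 1) * real n + 18 * real (n
      - 1)) / 30"
    by (rule sum_lessThan_closed_form[where P = "\<lambda>x. (12 * x ^ 5 - 30 * x ^ 4 * real n
        + 20 * x ^ 3 * real n ^ 2 - 15 * x ^ 4 + 60 * x ^ 3 * real n - 60 * x ^ 2 * real n ^ 2
        - 30 * x ^ 3 + 30 * x ^ 2 * real n + 40 * x * real n ^ 2 + 15 * x ^ 2 - 60 * x * real n
        + 18 * x) / 30" and f = "\<lambda>x. 2 * x ^ 4 - 4 * x ^ 3 * real n + 2 * x ^ 2 * real n ^ 2
        + 2 * x ^ 3 - 2 * x * real n ^ 2 - 2 * x ^ 2 + 4 * x * real n - 2 * x"])
       (simp, simp add: field_simps, algebra)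
  also have "\<dots> = ((2 * real n ^ 5 - 15 * real n ^ 4 + 40 * real n ^ 3 - 45 * real n ^ 2
      + 18 * real n) / 30)"
  proof -
    have *: "real (n - 1) = real n - 1" using assms by (simp add: of_nat_diff)
    show ?thesis unfolding * by (simp add: field_simps) algebra
  qed
  finally show ?thesis .
qed

text \<open>Only $a = b + 1 + e$ with $e < n - 1 - 2b$ contributes.\<close>

lemma sum_sums_inner:
  assumes "b > 0"
  shows "(\<Sum>a\<in>{1..<n}. real (a - b - 1) * (16 * real (n - a) * real (n - (a + b))
      + 16 * (real (n - (a + b)))\<^sup>2)) =
    (8 * real (n - 1 - 2 * b) ^ 4 + 8 * real (n - 1 - 2 * b) ^ 3 * real b
      - 8 * real (n - 1 - 2 * b) ^ 2 - 8 * real (n - 1 - 2 * b) * real b) / 3"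
proof -
  define K where "K = n - 1 - 2 * b"
  let ?f = "\<lambda>x. x * (16 * (real K - x + real b) * (real K - x) + 16 * (real K - x)\<^sup>2)"
  have "(\<Sum>a\<in>{1..<n}. real (a - b - 1) * (16 * real (n - a) * real (n - (a + b))
      + 16 * (real (n - (a + b)))\<^sup>2)) =
     (\<Sum>a\<in>{b + 1..<b + 1 + K}. real (a - b - 1) * (16 * real (n - a) * real (n - (a + b))
         + 16 * (real (n - (a + b)))\<^sup>2))"
  proof (rule sum.mono_neutral_right)
    show "{b + 1..<b + 1 + K} \<subseteq> {1..<n}" unfolding K_def by auto
    show "\<forall>a\<in>{1..<n} - {b + 1..<b + 1 + K}.
       real (a - b - 1) * (16 * real (n - a) * real (n - (a + b)) + 16 * (real (n - (a
           + b)))\<^sup>2) = 0"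
    proof
      fix a assume "a \<in> {1..<n} - {b + 1..<b + 1 + K}"
      then have "a - b - 1 = 0 \<or> n - (a + b) = 0" unfolding K_def by auto
      then show "real (a - b - 1) * (16 * real (n - a) * real (n - (a + b)) + 16 * (real (n - (a
          + b)))\<^sup>2) = 0"
        by auto
    qed
  qed simp
  also have "\<dots> = (\<Sum>e<K. ?f (real e))"
  proof (rule sum.reindex_bij_witness[of _ "\<lambda>e. b + 1 + e" "\<lambda>a. a - b - 1"])
    fix a assume a: "a \<in> {b + 1..<b + 1 + K}"
    have "real (n - (a + b)) = real K - real (a - b - 1)" "real (n - a) = real K - real (a - b - 1)
        + real b"
      using a unfolding K_def by auto
    then show "?f (real (a - b - 1)) =
        real (a - b - 1) * (16 * real (n - a) * real (n - (a + b)) + 16 * (real (n - (a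
            + b)))\<^sup>2)"
      by (simp only:)
  qed auto
  \<comment> \<open>The summand is 32 x (K-x)^2 + 16 b x (K-x); \<open>P\<close> is put together
    from the sums of first, second and third powers with \<open>K\<close> held fixed.\<close>
  also have "\<dots> = 32 * (real K ^ 2 * (real K ^ 2 - real K) / 2 - 2 * real K * ((2 * real K ^ 3
      - 3 * real K ^ 2 + real K) / 6)
      + (real K ^ 4 - 2 * real K ^ 3 + real K ^ 2) / 4) +
      16 * real b * (real K * (real K ^ 2 - real K) / 2 - (2 * real K ^ 3 - 3 * real K ^ 2
          + real K) / 6)"
    by (rule sum_lessThan_closed_form[where f = ?f and
       P = "\<lambda>x. 32 * (real K ^ 2 * (x ^ 2 - x) / 2 - 2 * real K * ((2 * x ^ 3 - 3 * x ^ 2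
           + x) / 6)
      + (x ^ 4 - 2 * x ^ 3 + x ^ 2) / 4) +
      16 * real b * (real K * (x ^ 2 - x) / 2 - (2 * x ^ 3 - 3 * x ^ 2 + x) / 6)"])
       (simp, simp add: field_simps, algebra)
  also have "\<dots> = (8 * real K ^ 4 + 8 * real K ^ 3 * real b - 8 * real K ^ 2
      - 8 * real K * real b) / 3"
    by (simp add: field_simps) algebra
  finally show ?thesis unfolding K_def .
qed

text \<open>Expanding the square separates 4 (n-a)^2 from the terms that carry the positive part of
  \<open>n - (a + b)\<close>. In the latter the sum over \<open>a\<close> is taken for fixed
  \<open>b\<close>, and what remains depends on parity.\<close>

lemma sum_sums_split:
  assumes "n > 0"
  shows "(\<Sum>a\<in>{1..<n}. \<Sum>b\<in>{1..<n}. real (a - b - 1) * (2 * real (n - a)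
      + 4 * real (n - (a + b)))\<^sup>2) =
    ((2 * real n ^ 5 - 15 * real n ^ 4 + 40 * real n ^ 3 - 45 * real n ^ 2 + 18 * real n) / 30) +
    (\<Sum>b\<in>{1..<n}. (8 * real (n - 1 - 2 * b) ^ 4 + 8 * real (n - 1 - 2 * b) ^ 3 * real b
      - 8 * real (n - 1 - 2 * b) ^ 2 - 8 * real (n - 1 - 2 * b) * real b) / 3)"
proof -
  have split: "real (a - b - 1) * (2 * real (n - a) + 4 * real (n - (a + b)))\<^sup>2 =
    real (a - b - 1) * (4 * (real (n - a))\<^sup>2) +
    real (a - b - 1) * (16 * real (n - a) * real (n - (a + b)) + 16 * (real (n - (a
        + b)))\<^sup>2)" for a b
    by algebra
  have "(\<Sum>a\<in>{1..<n}. \<Sum>b\<in>{1..<n}. real (a - b - 1) * (16 * real (n - a) * real (n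
      - (a + b)) + 16 * (real (n - (a + b)))\<^sup>2)) =
    (\<Sum>b\<in>{1..<n}. (8 * real (n - 1 - 2 * b) ^ 4 + 8 * real (n - 1 - 2 * b) ^ 3 * real b
      - 8 * real (n - 1 - 2 * b) ^ 2 - 8 * real (n - 1 - 2 * b) * real b) / 3)"
    by (subst sum.swap, intro sum.cong refl sum_sums_inner) auto
  then show ?thesis unfolding split sum.distrib sum_sums_first[OF assms] by (rule arg_cong)
qed

text \<open>With x = k - 1 - b the quantity \<open>n - 1 - 2 * b\<close> is 2x + 1, and it is
  truncated to 0 from \<open>b = k\<close> on.\<close>

lemma sum_sums_second_even:
  assumes "n = 2 * k" "k > 0"
  shows "(\<Sum>b\<in>{1..<n}. (8 * real (n - 1 - 2 * b) ^ 4 + 8 * real (n - 1 - 2 * b) ^ 3 * real b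
      - 8 * real (n - 1 - 2 * b) ^ 2 - 8 * real (n - 1 - 2 * b) * real b) / 3) = (144 * real k ^ 5
          - 680 * real k ^ 4 + 1120 * real k ^ 3 - 760 * real k ^ 2 + 176 * real k) / 15"
proof -
  let ?f = "\<lambda>x. (64 * x ^ 4 + 64 * x ^ 3 * real k + 96 * x ^ 3 + 96 * x ^ 2 * real k
      + 32 * x ^ 2 + 32 * x * real k) / 3"
  have "(\<Sum>b\<in>{1..<n}. (8 * real (n - 1 - 2 * b) ^ 4 + 8 * real (n - 1 - 2 * b) ^ 3 * real b
      - 8 * real (n - 1 - 2 * b) ^ 2 - 8 * real (n - 1 - 2 * b) * real b) / 3) =
      (\<Sum>b\<in>{1..k - 1}. ?f (real (k - 1 - b)))"
  proof (rule sum.mono_neutral_cong)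
    fix b assume "b \<in> {1..<n} \<inter> {1..k - 1}"
    then have *: "real b = real k - 1 - real (k - 1 - b)" "real (n - 1 - 2 * b) = 2 * real (k - 1
        - b) + 1"
      using assms by auto
    show "(8 * real (n - 1 - 2 * b) ^ 4 + 8 * real (n - 1 - 2 * b) ^ 3 * real b
      - 8 * real (n - 1 - 2 * b) ^ 2 - 8 * real (n - 1 - 2 * b) * real b) / 3 = ?f (real (k - 1
          - b))"
      unfolding * by (simp add: field_simps) algebra
  qed (use assms in auto)
  also have "\<dots> = (\<Sum>i<k - 1. ?f (real i))"
    by (rule sum_shift_diff_atMost[where F = "\<lambda>i. ?f (real i)"])
  also have "\<dots> = (64 * real (k - 1) ^ 5 + 80 * real (k - 1) ^ 4 * real k - 40 * real (k
      - 1) ^ 4 - 80 * real (k - 1) ^ 3 - 80 * real (k - 1) ^ 2 * real k + 40 * real (k - 1) ^ 2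
      + 16 * real (k - 1)) / 15"
    by (rule sum_lessThan_closed_form[where P = "\<lambda>x. (64 * x ^ 5 + 80 * x ^ 4 * real k
        - 40 * x ^ 4 - 80 * x ^ 3 - 80 * x ^ 2 * real k + 40 * x ^ 2 + 16 * x) / 15"])
       (simp, simp add: field_simps, algebra)
  also have "\<dots> = (144 * real k ^ 5 - 680 * real k ^ 4 + 1120 * real k ^ 3 - 760 * real k ^ 2
      + 176 * real k) / 15"
  proof -
    have *: "real (k - 1) = real k - 1" using assms by (simp add: of_nat_diff)
    show ?thesis unfolding * by (simp add: field_simps) algebra
  qed
  finally show ?thesis .
qed

text \<open>With x = k - b the quantity \<open>n - 1 - 2 * b\<close> is 2x.\<close>

lemma sum_sums_second_odd:
  assumes "n = 2 * k + 1"
  shows "(\<Sum>b\<in>{1..<n}. (8 * real (n - 1 - 2 * b) ^ 4 + 8 * real (n - 1 - 2 * b) ^ 3 * real b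
      - 8 * real (n - 1 - 2 * b) ^ 2 - 8 * real (n - 1 - 2 * b) * real b) / 3) = (144 * real k ^ 5
          - 320 * real k ^ 4 + 120 * real k ^ 3 + 80 * real k ^ 2 - 24 * real k) / 15"
proof -
  let ?f = "\<lambda>x. (64 * x ^ 4 + 64 * x ^ 3 * real k - 16 * x ^ 2 - 16 * x * real k) / 3"
  have "(\<Sum>b\<in>{1..<n}. (8 * real (n - 1 - 2 * b) ^ 4 + 8 * real (n - 1 - 2 * b) ^ 3 * real b
      - 8 * real (n - 1 - 2 * b) ^ 2 - 8 * real (n - 1 - 2 * b) * real b) / 3) =
      (\<Sum>b\<in>{1..k}. ?f (real (k - b)))"
  proof (rule sum.mono_neutral_cong)
    fix b assume "b \<in> {1..<n} \<inter> {1..k}"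
    then have *: "real b = real k - real (k - b)" "real (n - 1 - 2 * b) = 2 * real (k - b)"
      using assms by auto
    show "(8 * real (n - 1 - 2 * b) ^ 4 + 8 * real (n - 1 - 2 * b) ^ 3 * real b
      - 8 * real (n - 1 - 2 * b) ^ 2 - 8 * real (n - 1 - 2 * b) * real b) / 3 = ?f (real (k - b))"
      unfolding * by (simp add: field_simps) algebra
  qed (use assms in auto)
  also have "\<dots> = (\<Sum>i<k. ?f (real i))"
    by (rule sum_shift_diff_atMost[where F = "\<lambda>i. ?f (real i)"])
  also have "\<dots> = (64 * real k ^ 5 + 80 * real k ^ 4 * real k - 160 * real k ^ 4
      - 160 * real k ^ 3 * real k + 80 * real k ^ 3 + 40 * real k ^ 2 * real k + 40 * real k ^ 2
      + 40 * real k * real k - 24 * real k) / 15"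
    by (rule sum_lessThan_closed_form[where P = "\<lambda>x. (64 * x ^ 5 + 80 * x ^ 4 * real k
        - 160 * x ^ 4 - 160 * x ^ 3 * real k + 80 * x ^ 3 + 40 * x ^ 2 * real k + 40 * x ^ 2
        + 40 * x * real k - 24 * x) / 15"])
       (simp, simp add: field_simps, algebra)
  also have "\<dots> = (144 * real k ^ 5 - 320 * real k ^ 4 + 120 * real k ^ 3 + 80 * real k ^ 2
      - 24 * real k) / 15" by (simp add: field_simps; algebra?)
  finally show ?thesis .
qed

theorem theorem1p4:
  fixes l :: nat
  assumes "l > 0"
  shows "Pair_central_moment l 4 (\<lambda>(f, g). CDF f g) =
    (if even l
     then (80 * real l ^ 6 + 2208 * real l ^ 5 - 17080 * real l ^ 4 + 43640 * real l ^ 3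
             - 47020 * real l ^ 2 + 18352 * real l) / (15 * real l ^ 8)
     else (80 * real l ^ 6 + 2208 * real l ^ 5 - 17080 * real l ^ 4 + 43640 * real l ^ 3
             - 47380 * real l ^ 2 + 19792 * real l - 1260) / (15 * real l ^ 8))"
proof -
  define M where "M = (\<Sum>a\<in>{1..<l}. \<Sum>b\<in>{1..<l}. \<Sum>c\<in>{1..<l}. \<Sum>d\<in>{1..<l}.
    (real (balanced_count l a b c d))\<^sup>2)"
  note M = M_def[unfolded sum_square_balanced_count sum_same_closed sum_two_closed sum_three_closed sum_sums_split[OF assms]]
  \<comment> \<open>The moment is \<open>16 * M\<close> divided by the eighth power of
    \<open>l\<close>; the further factor 15 matches the denominator of the claim. Substituting
    \<open>l = 2 * k\<close> or \<open>l = 2 * k + 1\<close> turns each case into a polynomial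
    identity in \<open>k\<close>.\<close>
  have "240 * M = (if even l
     then 80 * real l ^ 6 + 2208 * real l ^ 5 - 17080 * real l ^ 4 + 43640 * real l ^ 3
             - 47020 * real l ^ 2 + 18352 * real l
     else 80 * real l ^ 6 + 2208 * real l ^ 5 - 17080 * real l ^ 4 + 43640 * real l ^ 3
             - 47380 * real l ^ 2 + 19792 * real l - 1260)"
  proof (cases "even l")
    case True
    then obtain k where k: "l = 2 * k" by (elim evenE)
    with assms have "k > 0" by simp
    have l: "real l = 2 * real k" using k by simp
    show ?thesis
      unfolding if_P[OF True] M sum_two_diag_even[OF k] sum_sums_second_even[OF k \<open>k > 0\<close>] l
      by (simp add: field_simps; algebra?)
  next
    case False
    then obtain k where k: "l = 2 * k + 1" by (elim oddE)
    have l: "real l = 2 * real k + 1" using k by simp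
    show ?thesis
      unfolding if_not_P[OF False] M sum_two_diag_odd[OF k] sum_sums_second_odd[OF k] l
      by (simp add: field_simps; algebra?)
  qed
  moreover have "Pair_central_moment l 4 (\<lambda>(f, g). CDF f g) = (240 * M) / (15 * real l ^ 8)"
    unfolding Pair_central_moment_4_CDF[OF assms] M_def[symmetric] by simp
  ultimately show ?thesis by (simp only: if_distrib[of "\<lambda>x. x / (15 * real l ^ 8)"])
qed

end
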